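(* Consider a channel whose OFF times have the hyper-exponential density $f_Y(t)=\sum_{i=1}^N p_i\lambda_ie^{-\lambda_it}$, where $\sum_{i=1}^N p_i=1$, and whose ON times have the exponential density $f_X(t)=\lambda_{ON}e^{-\lambda_{ON}t}$. Write the Laplace transform of $P_{OFF,OFF}(\Delta t)$ (defined in the context) as $$P^*_{OFF,OFF}(s)=\frac1s-\frac1{E(Y)}\frac{N(s)}{sD(s)},$$ with numerator and denominator polynomials $$N(s)=\sum_{i=1}^N p_i\prod_{j\ne i}(s+\lambda_j),\qquad D(s)=\prod_{i=1}^N(s+\lambda_i)+\lambda_{ON}N(s),$$ and let $r_1,\dots,r_N$ be the roots of $D$. Then $$P_{OFF,OFF}(\Delta t)=1-\frac1{E(Y)}\left(\lim_{s\to0}\frac{sN(s)e^{s\Delta t}}{s\prod_{k=1}^N(s-r_k)}+\sum_{i=1}^N\lim_{s\to r_i}\frac{(s-r_i)N(s)e^{s\Delta t}}{s\prod_{k=1}^N(s-r_k)}\right),$$ $$P_{ON,ON}(\Delta t)=1-\frac1{E(X)}\left(\lim_{s\to0}\frac{sN(s)e^{s\Delta t}}{s\prod_{k=1}^N(s-r_k)}+\sum_{i=1}^N\lim_{s\to r_i}\frac{(s-r_i)N(s)e^{s\Delta t}}{s\prod_{k=1}^N(s-r_k)}\right).$$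
   Context: A channel alternates between OFF periods (idle, free from the primary user) with density $f_Y$ and ON periods (occupied by the primary user) with density $f_X$. All durations are independent. $X$ and $Y$ denote random variables with densities $f_X$ and $f_Y$. The channel is sensed at time $t_0$, and $\Delta t$ is the time elapsed since then. $P_{OFF,OFF}(\Delta t)$ is the probability that the channel is OFF at time $t_0+\Delta t$ given that it is OFF at $t_0$, where the remaining OFF time at $t_0$ has density $\Pr(Y\ge r)/E(Y)$ and is followed by independent alternating ON and OFF periods with densities $f_X$ and $f_Y$. $P_{ON,ON}(\Delta t)$ is defined in the same way with the roles of ON and OFF (and of $f_X$ and $f_Y$) interchanged.
   Formalization: All weights p_i are taken strictly positive (rates too): with a zero weight, e.g. N=2, p=(1,0), λ_2=λ_1+λ_ON, D has a double root whose residue the formula counts twice, so the claim fails. *)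

theory Defs
  imports "HOL-Probability.Probability" "HOL-Computational_Algebra.Fundamental_Theorem_Algebra"
begin

section \<open>The channel\<close>

text \<open>A channel duration (an ON or an OFF period) is given by a density on the real line.\<close>

definition duration_law :: "(real \<Rightarrow> real) \<Rightarrow> real measure" where
  "duration_law f = density lborel (\<lambda>x. ennreal (f x))"

definition mean_duration :: "(real \<Rightarrow> real) \<Rightarrow> real" where
  "mean_duration f = (\<integral>x. x \<partial>duration_law f)"

definition residual_density :: "(real \<Rightarrow> real) \<Rightarrow> real \<Rightarrow> real" where
  "residual_density f r = (if r < 0 then 0 else measure (duration_law f) {r..} / mean_duration f)"

text \<open>
  The channel seen from the sensing time, where it is in the state whose full periods have
  density \<open>f\<close>; the periods of the other state have density \<open>g\<close>.  A sample point
  \<open>\<omega> :: nat \<Rightarrow> real\<close> lists the successive durations: \<open>\<omega> 0\<close> is the residual time in the initial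
  state, odd indices are periods of the other state, and positive even indices are full periods
  of the initial state.
\<close>

definition period_density :: "(real \<Rightarrow> real) \<Rightarrow> (real \<Rightarrow> real) \<Rightarrow> nat \<Rightarrow> real \<Rightarrow> real" where
  "period_density f g k = (if k = 0 then residual_density f else if odd k then g else f)"

definition channel_measure :: "(real \<Rightarrow> real) \<Rightarrow> (real \<Rightarrow> real) \<Rightarrow> (nat \<Rightarrow> real) measure" where
  "channel_measure f g = (\<Pi>\<^sub>M k\<in>UNIV. duration_law (period_density f g k))"

text \<open>At elapsed time \<open>t\<close> the channel is in its \<open>k\<close>-th period.\<close>

definition in_period :: "(nat \<Rightarrow> real) \<Rightarrow> nat \<Rightarrow> real \<Rightarrow> bool" where
  "in_period \<omega> k t \<longleftrightarrow> (\<Sum>j<k. \<omega> j) \<le> t \<and> t < (\<Sum>j<Suc k. \<omega> j)"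

definition same_state_prob :: "(real \<Rightarrow> real) \<Rightarrow> (real \<Rightarrow> real) \<Rightarrow> real \<Rightarrow> real" where
  "same_state_prob f g t =
     measure (channel_measure f g) {\<omega> \<in> space (channel_measure f g). \<exists>k. even k \<and> in_period \<omega> k t}"

definition P_OFF_OFF :: "(real \<Rightarrow> real) \<Rightarrow> (real \<Rightarrow> real) \<Rightarrow> real \<Rightarrow> real" where
  "P_OFF_OFF f_X f_Y = same_state_prob f_Y f_X"

definition P_ON_ON :: "(real \<Rightarrow> real) \<Rightarrow> (real \<Rightarrow> real) \<Rightarrow> real \<Rightarrow> real" where
  "P_ON_ON f_X f_Y = same_state_prob f_X f_Y"

section \<open>Hyper-exponential OFF times, exponential ON times\<close>

definition hyperexponential_density :: "nat \<Rightarrow> (nat \<Rightarrow> real) \<Rightarrow> (nat \<Rightarrow> real) \<Rightarrow> real \<Rightarrow> real" where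
  "hyperexponential_density n p lam t = (\<Sum>i=1..n. p i * exponential_density (lam i) t)"

definition N_poly :: "nat \<Rightarrow> (nat \<Rightarrow> real) \<Rightarrow> (nat \<Rightarrow> real) \<Rightarrow> complex poly" where
  "N_poly n p lam =
     (\<Sum>i=1..n. smult (complex_of_real (p i)) (\<Prod>j\<in>{1..n} - {i}. [:complex_of_real (lam j), 1:]))"

definition D_poly :: "nat \<Rightarrow> (nat \<Rightarrow> real) \<Rightarrow> (nat \<Rightarrow> real) \<Rightarrow> real \<Rightarrow> complex poly" where
  "D_poly n p lam lam_on =
     (\<Prod>i=1..n. [:complex_of_real (lam i), 1:]) + smult (complex_of_real lam_on) (N_poly n p lam)"

definition laplace_integrand :: "(real \<Rightarrow> real) \<Rightarrow> complex \<Rightarrow> real \<Rightarrow> complex" where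
  "laplace_integrand h s t = exp (- (s * complex_of_real t)) * complex_of_real (h t)"

definition laplace_transform :: "(real \<Rightarrow> real) \<Rightarrow> complex \<Rightarrow> complex" where
  "laplace_transform h s = (LINT t:{0..}|lborel. laplace_integrand h s t)"

end

(* Condition on the first period: the probabilities of being OFF satisfy a pair of renewal
   equations, whose bounded solution is unique by contraction. For exponential mixtures these
   equations follow from a linear ODE system: with a_mu the probability of being OFF after the
   start of an OFF period of rate mu, and b that after the start of an ON period,
     a_mu' = mu (b - a_mu),   b' = lam_on (sum q_mu a_mu - b),   a_mu(0) = 1,  b(0) = 0.
   Equal rates are merged first; then s D(s) has only simple roots, and sums of residues
   of M(s) exp(s t) / (s D(s)) solve the system, because d/dt multiplies M by s, multiples of s D(s)
   have no residues, and Lagrange interpolation gives the initial values. In particular b is lam_on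
   times the residue sum of N. Averaging the a_mu over the residual law gives P_OFF_OFF; the
   residual law of an exponential is itself, so P_ON_ON = 1 - b. *)

theory Submission
  imports Defs
begin

section \<open>Renewal equations for alternating periods\<close>

text \<open>No Laplace inversion takes place: explicit residue sums are proposed and verified, and
  the transform of \<open>P_OFF_OFF\<close> is computed from them afterwards. The proposal is the
  formal solution of the transformed system, (s + mu) a_mu = 1 + mu b and (s + lam_on) b = lam_on
  (sum q_mu a_mu), whose common denominator is s D(s). Merging equal rates is forced: a repeated
  rate gives N and D a common factor, s D(s) may then have multiple roots, and terms with Q' in the
  denominator break down there. With distinct rates and positive weights, D divided by the product
  of the s + mu is 1 + lam_on (sum q_mu / (s + mu)), whose zeros are real, negative and simple. The
  contraction comes from the ON law alone: an exponential time exceeds any T with positive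
  probability.\<close>

lemma ball_nat_split: "(\<forall>k\<in>J. P k) \<longleftrightarrow> (0 \<in> J \<longrightarrow> P 0) \<and> (\<forall>k\<in>Suc -` J. P (Suc k))"
proof (intro iffI conjI ballI impI)
  fix k assume "(0 \<in> J \<longrightarrow> P 0) \<and> (\<forall>k\<in>Suc -` J. P (Suc k))" "k \<in> J"
  then show "P k" by (cases k) auto
qed auto

lemma measurable_case_nat_PiM:
  "(\<lambda>z. case_nat (fst z) (snd z)) \<in> M 0 \<Otimes>\<^sub>M (\<Pi>\<^sub>M i\<in>UNIV. M (Suc i)) \<rightarrow>\<^sub>M (\<Pi>\<^sub>M i\<in>UNIV. M i)"
proof (rule measurable_PiM_single')
  fix i :: nat
  show "(\<lambda>z. case_nat (fst z) (snd z) i) \<in> M 0 \<Otimes>\<^sub>M (\<Pi>\<^sub>M i\<in>UNIV. M (Suc i)) \<rightarrow>\<^sub>M M i"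
    by (cases i) auto
qed (auto simp: space_pair_measure space_PiM PiE_iff split: nat.split)

lemma distr_PiM_case_nat:
  fixes M :: "nat \<Rightarrow> 'a measure"
  assumes M: "\<And>i. prob_space (M i)"
  shows "distr (M 0 \<Otimes>\<^sub>M (\<Pi>\<^sub>M i\<in>UNIV. M (Suc i))) (\<Pi>\<^sub>M i\<in>UNIV. M i) (\<lambda>z. case_nat (fst z) (snd z)) =
    (\<Pi>\<^sub>M i\<in>UNIV. M i)"  (is "?L = ?R")
proof (rule measure_eqI_PiM_infinite[symmetric, OF refl])
  interpret M0: prob_space "M 0" by (rule M)
  interpret S: prob_space "\<Pi>\<^sub>M i\<in>UNIV. M (Suc i)" by (intro prob_space_PiM M)
  interpret R: prob_space ?R by (intro prob_space_PiM M)
  show "finite_measure ?R" by unfold_locales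
  note measurable_case_nat_PiM[measurable]
  fix J :: "nat set" and A assume J: "finite J" "J \<subseteq> UNIV" and A: "\<And>i. i \<in> J \<Longrightarrow> A i \<in> sets (M i)"
  let ?X = "prod_emb UNIV M J (Pi\<^sub>E J A)" and ?K = "Suc -` J"
  \<comment> \<open>If J omits 0, the first coordinate is unconstrained and contributes the factor
    1.\<close>
  let ?A0 = "if 0 \<in> J then A 0 else space (M 0)"
  have K: "finite ?K" using J by (simp add: finite_vimageI)
  have "range Suc = UNIV - {0}" by (auto simp: image_iff) (metis not0_implies_Suc)
  then have img: "Suc ` ?K = J - {0}" by (auto simp: image_vimage_eq)
  have "?R ?X = (\<Prod>i\<in>J. M i (A i))"
    using M J A by (intro emeasure_PiM_emb) auto
  also have "\<dots> = M 0 ?A0 * (\<Prod>i\<in>J-{0}. M i (A i))"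
    using prod.insert_remove[of J "\<lambda>i. M i (A i)" 0] J M0.emeasure_space_1
    by (cases "0 \<in> J") (auto simp: insert_absorb)
  also have "(\<Prod>i\<in>J-{0}. M i (A i)) = (\<Prod>i\<in>?K. M (Suc i) (A (Suc i)))"
    unfolding img[symmetric] by (subst prod.reindex) auto
  also have "\<dots> = (\<Pi>\<^sub>M i\<in>UNIV. M (Suc i))
      (prod_emb UNIV (\<lambda>i. M (Suc i)) ?K (Pi\<^sub>E ?K (\<lambda>i. A (Suc i))))"
    using M K A by (intro emeasure_PiM_emb[symmetric]) auto
  also have "M 0 ?A0 * \<dots> = (M 0 \<Otimes>\<^sub>M (\<Pi>\<^sub>M i\<in>UNIV. M (Suc i)))
      (?A0 \<times> prod_emb UNIV (\<lambda>i. M (Suc i)) ?K (Pi\<^sub>E ?K (\<lambda>i. A (Suc i))))"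
    using K A by (intro S.emeasure_pair_measure_Times[symmetric] sets_PiM_I) auto
  also have "?A0 \<times> prod_emb UNIV (\<lambda>i. M (Suc i)) ?K (Pi\<^sub>E ?K (\<lambda>i. A (Suc i))) =
      (\<lambda>z. case_nat (fst z) (snd z)) -` ?X \<inter> space (M 0 \<Otimes>\<^sub>M (\<Pi>\<^sub>M i\<in>UNIV. M (Suc i)))"
  proof (intro set_eqI, clarify)
    fix x \<omega>
    have "case_nat x \<omega> \<in> Pi J A \<longleftrightarrow> (0 \<in> J \<longrightarrow> x \<in> A 0) \<and> \<omega> \<in> Pi ?K (\<lambda>i. A (Suc i))"
      unfolding Pi_iff by (subst ball_nat_split) auto
    moreover have "case_nat x \<omega> \<in> (\<Pi> i\<in>UNIV. space (M i)) \<longleftrightarrow> x \<in> space (M 0) \<and> \<omega> \<in> (\<Pi> i\<in>UNIV. space (M (Suc i)))"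
      unfolding Pi_iff by (subst ball_nat_split) auto
    moreover have "0 \<in> J \<Longrightarrow> x \<in> A 0 \<Longrightarrow> x \<in> space (M 0)"
      using A[of 0, THEN sets.sets_into_space] by auto
    ultimately show "(x, \<omega>) \<in> ?A0 \<times> prod_emb UNIV (\<lambda>i. M (Suc i)) ?K (Pi\<^sub>E ?K (\<lambda>i. A (Suc i))) \<longleftrightarrow>
      (x, \<omega>) \<in> (\<lambda>z. case_nat (fst z) (snd z)) -` ?X \<inter> space (M 0 \<Otimes>\<^sub>M (\<Pi>\<^sub>M i\<in>UNIV. M (Suc i)))"
      by (auto simp: prod_emb_def space_pair_measure space_PiM PiE_iff Pi_iff)
  qed
  finally show "?R ?X = ?L ?X"
    using J A by (simp add: emeasure_distr)
qed simp

section \<open>Being in a period of given parity\<close>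

definition parity_event :: "bool \<Rightarrow> real \<Rightarrow> (nat \<Rightarrow> real) \<Rightarrow> bool" where
  "parity_event par t \<omega> \<longleftrightarrow> (\<exists>k. even k = par \<and> in_period \<omega> k t)"

text \<open>The parity is an argument because dropping the first period exchanges even and odd
  indices. The laws are arbitrary so that a residual first period is covered.\<close>

definition parity_prob :: "(nat \<Rightarrow> real measure) \<Rightarrow> bool \<Rightarrow> real \<Rightarrow> real" where
  "parity_prob M par t = measure (\<Pi>\<^sub>M k\<in>UNIV. M k) {\<omega> \<in> space (\<Pi>\<^sub>M k\<in>UNIV. M k). parity_event par t \<omega>}"

lemma in_period_case_nat_Suc: "in_period (case_nat x \<omega>) (Suc k) t \<longleftrightarrow> in_period \<omega> k (t - x)"
  unfolding in_period_def sum.lessThan_Suc_shift by (simp add: algebra_simps)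

text \<open>The disjuncts can overlap when durations are negative, since then t - x < 0 may still
  lie in a period; \<open>parity_prob_neg\<close> shows that this has probability 0.\<close>

lemma parity_event_case_nat:
  assumes "0 \<le> t"
  shows "parity_event par t (case_nat x \<omega>) \<longleftrightarrow> par \<and> t < x \<or> parity_event (\<not> par) (t - x) \<omega>"
proof -
  have split: "(\<exists>k. P k) \<longleftrightarrow> P 0 \<or> (\<exists>k. P (Suc k))" for P :: "nat \<Rightarrow> bool"
    by (metis not0_implies_Suc)
  have zero: "in_period (case_nat x \<omega>) 0 t \<longleftrightarrow> t < x"
    using assms by (simp add: in_period_def)
  have flip: "(even (Suc k) = par) = (even k = (\<not> par))" for k
    by auto
  show ?thesis
    unfolding parity_event_def by (subst split, unfold in_period_case_nat_Suc flip zero) simp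
qed

text \<open>Joint measurability in time and path makes \<open>parity_prob\<close> measurable in the
  time, as the measure of sections of one set.\<close>

lemma measurable_parity_event [measurable]:
  assumes "\<And>i. sets (M i) = sets borel"
  shows "Measurable.pred (borel \<Otimes>\<^sub>M (\<Pi>\<^sub>M k\<in>UNIV. M k)) (\<lambda>z. parity_event par (fst z) (snd z))"
proof -
  have c: "(\<lambda>z. snd z i) \<in> borel_measurable (borel \<Otimes>\<^sub>M (\<Pi>\<^sub>M k\<in>UNIV. M k))" for i :: nat
  proof -
    have "(\<lambda>\<omega>. \<omega> i) \<in> (\<Pi>\<^sub>M k\<in>UNIV. M k) \<rightarrow>\<^sub>M M i" by simp
    also have "\<dots> = borel_measurable (\<Pi>\<^sub>M k\<in>UNIV. M k)"
      by (rule measurable_cong_sets) (use assms in auto)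
    finally show ?thesis by (rule measurable_compose_rev) simp
  qed
  have [measurable]: "(\<lambda>z. \<Sum>j<k. snd z j) \<in> borel_measurable (borel \<Otimes>\<^sub>M (\<Pi>\<^sub>M k\<in>UNIV. M k))" for k
    by (intro borel_measurable_sum c)
  show ?thesis unfolding parity_event_def in_period_def by measurable
qed

lemma parity_event_sets:
  assumes "\<And>i. sets (M i) = sets borel"
  shows "{\<omega> \<in> space (\<Pi>\<^sub>M k\<in>UNIV. M k). parity_event par t \<omega>} \<in> sets (\<Pi>\<^sub>M k\<in>UNIV. M k)"
proof -
  have "(\<lambda>\<omega>. (t, \<omega>)) \<in> (\<Pi>\<^sub>M k\<in>UNIV. M k) \<rightarrow>\<^sub>M borel \<Otimes>\<^sub>M (\<Pi>\<^sub>M k\<in>UNIV. M k)" by simp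
  from measurable_compose[OF this measurable_parity_event[OF assms]]
  show ?thesis by (simp add: pred_def)
qed

locale renewal_sequence =
  fixes M :: "nat \<Rightarrow> real measure"
  assumes prob [simp]: "\<And>i. prob_space (M i)"
    and sets_M [simp]: "\<And>i. sets (M i) = sets borel"
    and nonneg: "\<And>i. AE x in M i. 0 \<le> x"
begin

lemma prob_space_seq: "prob_space (\<Pi>\<^sub>M k\<in>UNIV. M k)"
  by (intro prob_space_PiM prob)

lemma shift: "renewal_sequence (\<lambda>i. M (Suc i))"
  by (rule renewal_sequence.intro) (rule prob sets_M nonneg)+

lemma parity_prob_bounds: "0 \<le> parity_prob M par t" "parity_prob M par t \<le> 1"
  using prob_space.prob_le_1[OF prob_space_seq] by (auto simp: parity_prob_def)

lemma measurable_parity_prob [measurable]: "parity_prob M par \<in> borel_measurable borel"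
proof -
  interpret P: prob_space "\<Pi>\<^sub>M k\<in>UNIV. M k" by (rule prob_space_seq)
  let ?E = "{z \<in> space (borel \<Otimes>\<^sub>M (\<Pi>\<^sub>M k\<in>UNIV. M k)). parity_event par (fst z) (snd z)}"
  have "?E \<in> sets (borel \<Otimes>\<^sub>M (\<Pi>\<^sub>M k\<in>UNIV. M k))"
    using measurable_parity_event[of M par] by (simp add: pred_def)
  from P.measurable_emeasure_Pair[OF this]
  have "(\<lambda>t. enn2real (emeasure (\<Pi>\<^sub>M k\<in>UNIV. M k) (Pair t -` ?E))) \<in> borel_measurable borel"
    by measurable
  also have "(\<lambda>t. enn2real (emeasure (\<Pi>\<^sub>M k\<in>UNIV. M k) (Pair t -` ?E))) = parity_prob M par"
    by (auto simp: parity_prob_def measure_def fun_eq_iff space_pair_measure intro!: arg_cong[where f="\<lambda>A. enn2real (emeasure _ A)"])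
  finally show ?thesis .
qed

text \<open>Almost surely all partial sums are nonnegative, so no period starts before time
  0.\<close>

lemma parity_prob_neg:
  assumes "t < 0" shows "parity_prob M par t = 0"
proof -
  interpret P: prob_space "\<Pi>\<^sub>M k\<in>UNIV. M k" by (rule prob_space_seq)
  have "AE \<omega> in \<Pi>\<^sub>M k\<in>UNIV. M k. \<forall>i. 0 \<le> \<omega> i"
    unfolding AE_all_countable by (intro allI AE_PiM_component[of UNIV M]) (auto intro: nonneg)
  then have "AE \<omega> in \<Pi>\<^sub>M k\<in>UNIV. M k. \<not> parity_event par t \<omega>"
  proof eventually_elim
    case (elim \<omega>)
    then have "0 \<le> (\<Sum>j<k. \<omega> j)" for k by (intro sum_nonneg) auto
    then show ?case using assms unfolding parity_event_def in_period_def
      by (meson le_less_trans not_less order_trans)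
  qed
  then have "measure (\<Pi>\<^sub>M k\<in>UNIV. M k) {\<omega> \<in> space (\<Pi>\<^sub>M k\<in>UNIV. M k). parity_event par t \<omega>} = measure (\<Pi>\<^sub>M k\<in>UNIV. M k) {}"
    by (intro measure_eq_AE parity_event_sets) auto
  then show ?thesis by (simp add: parity_prob_def)
qed

lemma parity_prob_renewal:
  assumes "0 \<le> t"
  shows "parity_prob M par t =
    (\<integral>x. (if x \<le> t then parity_prob (\<lambda>i. M (Suc i)) (\<not> par) (t - x) else of_bool par) \<partial>M 0)"
proof -
  interpret S: renewal_sequence "\<lambda>i. M (Suc i)" by (rule shift)
  let ?P = "\<Pi>\<^sub>M k\<in>UNIV. M k" and ?S = "\<Pi>\<^sub>M k\<in>UNIV. M (Suc k)"
  let ?E = "{\<omega> \<in> space ?P. parity_event par t \<omega>}"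
  let ?f = "\<lambda>x. if x \<le> t then parity_prob (\<lambda>i. M (Suc i)) (\<not> par) (t - x) else of_bool par"
  interpret P: prob_space ?P by (rule prob_space_seq)
  interpret Sp: prob_space ?S by (rule S.prob_space_seq)
  interpret M0: prob_space "M 0" by (rule prob)
  have eq: "distr (M 0 \<Otimes>\<^sub>M ?S) ?P (\<lambda>z. case_nat (fst z) (snd z)) = ?P"
    by (rule distr_PiM_case_nat[OF prob])
  note meas = measurable_case_nat_PiM[of M]
  have E: "?E \<in> sets ?P" by (rule parity_event_sets) simp
  have space0: "space (M i) = UNIV" for i using sets_eq_imp_space_eq[OF sets_M[of i]] by simp
  have f01: "0 \<le> ?f x" "?f x \<le> 1" for x
    using S.parity_prob_bounds by auto
  have fm: "?f \<in> borel_measurable (M 0)"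
    by (subst measurable_cong_sets[OF sets_M refl]) measurable
  have "emeasure ?P ?E = (\<integral>\<^sup>+x. emeasure ?S (Pair x -` ((\<lambda>z. case_nat (fst z) (snd z)) -` ?E \<inter> space (M 0 \<Otimes>\<^sub>M ?S))) \<partial>M 0)"
    by (subst eq[symmetric], subst emeasure_distr[OF meas E],
        rule Sp.emeasure_pair_measure_alt[OF measurable_sets[OF meas E]])
  also have "\<dots> = (\<integral>\<^sup>+x. ennreal (?f x) \<partial>M 0)"
  proof (intro nn_integral_cong)
    fix x assume "x \<in> space (M 0)"
    have *: "Pair x -` ((\<lambda>z. case_nat (fst z) (snd z)) -` ?E \<inter> space (M 0 \<Otimes>\<^sub>M ?S)) =
       {\<omega> \<in> space ?S. par \<and> t < x \<or> parity_event (\<not> par) (t - x) \<omega>}"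
      by (auto simp: space_pair_measure space0 space_PiM parity_event_case_nat[OF assms])
    show "emeasure ?S (Pair x -` ((\<lambda>z. case_nat (fst z) (snd z)) -` ?E \<inter> space (M 0 \<Otimes>\<^sub>M ?S))) = ennreal (?f x)"
    \<comment> \<open>If t < x, the restarted sequence is asked about a negative time, a null event,
      and only the truth value \<open>par\<close> remains.\<close>
    proof (cases "t < x")
      case True
      then show ?thesis
        using S.parity_prob_neg[of "t - x" "\<not> par"] Sp.emeasure_space_1 unfolding *
        by (auto simp: parity_prob_def Sp.emeasure_eq_measure)
    next
      case False
      then show ?thesis unfolding *
        by (auto simp: parity_prob_def Sp.emeasure_eq_measure not_less)
    qed
  qed
  also have "\<dots> = ennreal (\<integral>x. ?f x \<partial>M 0)"
    using f01 fm by (intro nn_integral_eq_integral M0.integrable_const_bound[where B=1]) auto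
  finally have "ennreal (parity_prob M par t) = ennreal (\<integral>x. ?f x \<partial>M 0)"
    by (simp add: P.emeasure_eq_measure parity_prob_def)
  then show ?thesis
    using f01 by (subst (asm) ennreal_inj) (auto simp: parity_prob_def)
qed

end

text \<open>The equation for \<open>u\<close> contracts the supremum norm on \<open>[0, T]\<close> by the factor
  \<open>F {..T} < 1\<close>, so no measurability of \<open>u\<close> and \<open>v\<close> is needed.\<close>

lemma renewal_equation_unique:
  fixes u v :: "real \<Rightarrow> complex" and F G :: "real measure"
  assumes F: "prob_space F" "sets F = sets borel" "AE x in F. 0 \<le> x"
    and G: "prob_space G" "sets G = sets borel" "AE x in G. 0 \<le> x"
    and F1: "\<And>T. measure F {..T} < 1"
    and u_eq: "\<And>t. 0 \<le> t \<Longrightarrow> u t = (\<integral>x. (if x \<le> t then v (t - x) else 0) \<partial>F)"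
    and v_eq: "\<And>t. 0 \<le> t \<Longrightarrow> v t = (\<integral>x. (if x \<le> t then u (t - x) else 0) \<partial>G)"
    and bnd: "\<And>T. \<exists>B. \<forall>t\<in>{0..T}. norm (u t) \<le> B"
    and t: "0 \<le> t"
  shows "u t = 0" "v t = 0"
proof -
  have conv_bound: "norm (\<integral>x. (if x \<le> s then w (s - x) else 0) \<partial>H) \<le> K * measure H {..t}"
    if H: "prob_space H" "sets H = sets borel" "AE x in H. 0 \<le> x"
      and w: "\<And>s. s \<in> {0..t} \<Longrightarrow> norm (w s) \<le> K" and s: "s \<in> {0..t}"
    for H K s and w :: "real \<Rightarrow> complex"
  proof -
    interpret H: prob_space H by fact
    have K: "0 \<le> K" using w[OF s] norm_ge_zero order_trans by blast
    have sp: "space H = UNIV" using sets_eq_imp_space_eq[OF H(2)] by simp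
    have meas: "{..s} \<in> sets H" "{..t} \<in> sets H" using H(2) by auto
    \<comment> \<open>Both estimates survive a non-integrable integrand, whose integral is 0 by
      convention; only the majorant has to be integrable and nonnegative.\<close>
    have "norm (\<integral>x. (if x \<le> s then w (s - x) else 0) \<partial>H) \<le> (\<integral>x. norm (if x \<le> s then w (s - x) else 0) \<partial>H)"
      by (rule integral_norm_bound)
    also have "\<dots> \<le> (\<integral>x. K * indicator {..s} x \<partial>H)"
    proof (rule integral_mono_AE')
      show "integrable H (\<lambda>x. K * indicator {..s} x)"
        using meas by (intro integrable_mult_right) (auto simp: H.emeasure_eq_measure)
      show "AE x in H. norm (if x \<le> s then w (s - x) else 0) \<le> K * indicator {..s} x"
        using H(3) by eventually_elim (use s w in \<open>auto simp: indicator_def\<close>)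
      show "AE x in H. 0 \<le> K * indicator {..s} x" using K by simp
    qed
    also have "\<dots> = K * measure H {..s}" using sp by simp
    also have "\<dots> \<le> K * measure H {..t}"
      using s K meas by (intro mult_left_mono H.finite_measure_mono) auto
    finally show ?thesis .
  qed
  define c where "c = measure F {..t}"
  have c: "0 \<le> c" "c < 1" using F1 by (auto simp: c_def)
  obtain B where B: "\<And>s. s \<in> {0..t} \<Longrightarrow> norm (u s) \<le> B" using bnd by blast
  have v_le: "norm (v s) \<le> K" if "\<And>s. s \<in> {0..t} \<Longrightarrow> norm (u s) \<le> K" "s \<in> {0..t}" for K s
  proof -
    have K: "0 \<le> K" using that norm_ge_zero order_trans by blast
    have "norm (v s) \<le> K * measure G {..t}"
      using conv_bound[OF G that] v_eq[of s] that(2) by simp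
    \<comment> \<open>For G a mass of at most 1 is enough; the strict factor comes from F.\<close>
    also have "\<dots> \<le> K * 1"
      using K G(1) by (intro mult_left_mono) (auto intro: prob_space.prob_le_1)
    finally show ?thesis by simp
  qed
  have u_le: "\<forall>s\<in>{0..t}. norm (u s) \<le> B * c ^ k" for k
  proof (induction k)
    case 0
    then show ?case using B by simp
  next
    case (Suc k)
    then have "norm (v s) \<le> B * c ^ k" if "s \<in> {0..t}" for s
      using v_le that by blast
    then have "norm (u s) \<le> B * c ^ k * c" if "s \<in> {0..t}" for s
      using conv_bound[OF F, of v "B * c ^ k" s] that u_eq[of s] by (simp add: c_def)
    then show ?case by (simp add: mult_ac)
  qed
  have lim: "(\<lambda>k. B * c ^ k) \<longlonglongrightarrow> B * 0"
    by (intro tendsto_intros LIMSEQ_power_zero) (use c in auto)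
  have u0: "norm (u s) \<le> 0" if "s \<in> {0..t}" for s
    using tendsto_lowerbound[OF lim, of "norm (u s)"] u_le that by auto
  show "u t = 0" using u0[of t] t by simp
  show "v t = 0" using v_le[of 0 t] u0 t by simp
qed

section \<open>Exponential mixtures\<close>

text \<open>Indexing by the rates themselves makes the rates of different summands distinct.\<close>

definition exponential_mixture :: "real set \<Rightarrow> (real \<Rightarrow> real) \<Rightarrow> real \<Rightarrow> real" where
  "exponential_mixture S w x = (\<Sum>\<mu>\<in>S. w \<mu> * exponential_density \<mu> x)"

lemma measurable_exponential_mixture [measurable]: "exponential_mixture S w \<in> borel_measurable borel"
  unfolding exponential_mixture_def[abs_def] by measurable

lemma sets_duration_law [simp, measurable_cong]: "sets (duration_law f) = sets borel"
  by (simp add: duration_law_def)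

lemma space_duration_law [simp]: "space (duration_law f) = UNIV"
  by (simp add: duration_law_def)

lemma prob_space_exponential_law: "0 < k \<Longrightarrow> prob_space (duration_law (exponential_density k))"
  unfolding duration_law_def by (rule prob_space_exponential_density)

text \<open>Linearity of the integral in the density. Nonnegative weights matter because
  \<open>duration_law\<close> cuts negative density values to 0 through
  \<open>ennreal\<close>.\<close>

lemma has_bochner_integral_exponential_mixture:
  fixes h :: "real \<Rightarrow> 'b :: {banach, second_countable_topology}"
  assumes S: "finite S" "\<And>\<mu>. \<mu> \<in> S \<Longrightarrow> 0 < \<mu>" "\<And>\<mu>. \<mu> \<in> S \<Longrightarrow> 0 \<le> w \<mu>"
    and h: "\<And>\<mu>. \<mu> \<in> S \<Longrightarrow> has_bochner_integral (duration_law (exponential_density \<mu>)) h (I \<mu>)"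
    and hm: "h \<in> borel_measurable borel"
  shows "has_bochner_integral (duration_law (exponential_mixture S w)) h (\<Sum>\<mu>\<in>S. w \<mu> *\<^sub>R I \<mu>)"
proof -
  have hm': "h \<in> borel_measurable lborel" using hm by simp
  have nn: "0 \<le> exponential_mixture S w x" for x
    unfolding exponential_mixture_def using S by (intro sum_nonneg mult_nonneg_nonneg exponential_density_nonneg) auto
  have "has_bochner_integral lborel (\<lambda>x. w \<mu> *\<^sub>R (exponential_density \<mu> x *\<^sub>R h x)) (w \<mu> *\<^sub>R I \<mu>)" if "\<mu> \<in> S" for \<mu>
  proof -
    have "AE x in lborel. 0 \<le> exponential_density \<mu> x" using S(2)[OF that] by auto
    then have "has_bochner_integral lborel (\<lambda>x. exponential_density \<mu> x *\<^sub>R h x) (I \<mu>)"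
      using h[OF that] hm' unfolding duration_law_def has_bochner_integral_iff
      by (subst (asm) integrable_density, simp, simp, simp, subst (asm) integral_density, simp, simp, simp, simp)
    then show ?thesis by (intro has_bochner_integral_scaleR_right) auto
  qed
  then have "has_bochner_integral lborel (\<lambda>x. \<Sum>\<mu>\<in>S. w \<mu> *\<^sub>R (exponential_density \<mu> x *\<^sub>R h x)) (\<Sum>\<mu>\<in>S. w \<mu> *\<^sub>R I \<mu>)"
    by (rule has_bochner_integral_sum)
  also have "(\<lambda>x. \<Sum>\<mu>\<in>S. w \<mu> *\<^sub>R (exponential_density \<mu> x *\<^sub>R h x)) = (\<lambda>x. exponential_mixture S w x *\<^sub>R h x)"
    by (simp add: exponential_mixture_def scaleR_sum_left)
  finally show ?thesis
    unfolding duration_law_def using hm' nn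
    by (intro has_bochner_integral_density) auto
qed

text \<open>Convolution with an exponential law solves a linear ODE: this trades the renewal equations
  for differential ones.\<close>

lemma exponential_renewal_integral:
  fixes u v :: "real \<Rightarrow> complex"
  assumes k: "0 < k" and t: "0 \<le> t"
    and u: "\<And>x. (u has_vector_derivative of_real k * (v x - u x)) (at x)"
    and v: "continuous_on UNIV v"
  shows "has_bochner_integral (duration_law (exponential_density k)) (\<lambda>x. if x \<le> t then v (t - x) else u 0) (u t)"
proof -
  \<comment> \<open>Subtracting the constant \<open>u 0\<close> leaves an integrand supported in
    [0, t]; the constant is integrated separately.\<close>
  let ?h = "\<lambda>x. if x \<le> t then v (t - x) - u 0 else 0"
  interpret P: prob_space "duration_law (exponential_density k)" by (rule prob_space_exponential_law[OF k])
  \<comment> \<open>This is the derivative of -exp(-k x) (u(t - x) - u(0)): the ODE cancels the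
    terms in u(t - x). The antiderivative vanishes at x = t.\<close>
  let ?f = "\<lambda>x. exp (- k * x) *\<^sub>R (of_real k * (v (t - x) - u 0))"
  have contu: "continuous_on UNIV u"
    using u by (meson continuous_at_imp_continuous_on has_vector_derivative_continuous)
  have [measurable]: "v \<in> borel_measurable borel" using v by (rule borel_measurable_continuous_onI)
  have "has_bochner_integral lborel (\<lambda>x. indicator {0..t} x *\<^sub>R ?f x)
     (- (exp (- k * t) *\<^sub>R (u (t - t) - u 0)) - - (exp (- k * 0) *\<^sub>R (u (t - 0) - u 0)))"
  proof (rule has_bochner_integral_FTC_Icc[OF t])
    fix x assume "0 \<le> x" "x \<le> t"
    have "((\<lambda>x. t - x) has_vector_derivative -1) (at x)"
      by (auto simp: has_real_derivative_iff_has_vector_derivative[symmetric] intro!: derivative_eq_intros)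
    from vector_diff_chain_at[OF this u]
    have "((\<lambda>x. u (t - x)) has_vector_derivative - (of_real k * (v (t - x) - u (t - x)))) (at x)"
      by (simp add: o_def)
    then have "((\<lambda>x. - (exp (- k * x) *\<^sub>R (u (t - x) - u 0))) has_vector_derivative ?f x) (at x)"
      by (auto intro!: derivative_eq_intros simp: algebra_simps scaleR_conv_of_real has_real_derivative_iff_has_vector_derivative[symmetric])
    then show "((\<lambda>x. - (exp (- k * x) *\<^sub>R (u (t - x) - u 0))) has_vector_derivative ?f x) (at x within {0..t})"
      by (rule has_vector_derivative_at_within)
  next
    show "continuous_on {0..t} ?f"
      by (intro continuous_intros continuous_on_compose2[OF v]) auto
  qed
  also have "(\<lambda>x. indicator {0..t} x *\<^sub>R ?f x) = (\<lambda>x. exponential_density k x *\<^sub>R ?h x)"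
    by (auto simp: fun_eq_iff exponential_density_def indicator_def scaleR_conv_of_real mult_ac)
  finally have "has_bochner_integral lborel (\<lambda>x. exponential_density k x *\<^sub>R ?h x) (u t - u 0)"
    by simp
  then have "has_bochner_integral (duration_law (exponential_density k)) ?h (u t - u 0)"
    unfolding duration_law_def using k by (intro has_bochner_integral_density) (auto intro!: exponential_density_nonneg)
  moreover have "has_bochner_integral (duration_law (exponential_density k)) (\<lambda>x. u 0) (u 0)"
    using P.prob_space by (simp add: has_bochner_integral_iff)
  ultimately have "has_bochner_integral (duration_law (exponential_density k)) (\<lambda>x. ?h x + u 0) (u t - u 0 + u 0)"
    by (rule has_bochner_integral_add)
  also have "(\<lambda>x. ?h x + u 0) = (\<lambda>x. if x \<le> t then v (t - x) else u 0)" by auto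
  finally show ?thesis by simp
qed

text \<open>All components share the driving function v and the initial value c, so they can be
  averaged. The weights are free: the same solutions serve the OFF law and its residual law.\<close>

lemma exponential_mixture_renewal_integral:
  fixes u :: "real \<Rightarrow> real \<Rightarrow> complex" and v :: "real \<Rightarrow> complex"
  assumes S: "finite S" "\<And>\<mu>. \<mu> \<in> S \<Longrightarrow> 0 < \<mu>" "\<And>\<mu>. \<mu> \<in> S \<Longrightarrow> 0 \<le> w \<mu>"
    and t: "0 \<le> t"
    and u: "\<And>\<mu> x. \<mu> \<in> S \<Longrightarrow> (u \<mu> has_vector_derivative of_real \<mu> * (v x - u \<mu> x)) (at x)"
    and u0: "\<And>\<mu>. \<mu> \<in> S \<Longrightarrow> u \<mu> 0 = c"
    and v: "continuous_on UNIV v"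
  shows "has_bochner_integral (duration_law (exponential_mixture S w))
    (\<lambda>x. if x \<le> t then v (t - x) else c) (\<Sum>\<mu>\<in>S. w \<mu> *\<^sub>R u \<mu> t)"
proof (rule has_bochner_integral_exponential_mixture[OF S])
  have [measurable]: "v \<in> borel_measurable borel" using v by (rule borel_measurable_continuous_onI)
  show "(\<lambda>x. if x \<le> t then v (t - x) else c) \<in> borel_measurable borel" by measurable
  show "has_bochner_integral (duration_law (exponential_density \<mu>)) (\<lambda>x. if x \<le> t then v (t - x) else c) (u \<mu> t)"
    if "\<mu> \<in> S" for \<mu>
    using exponential_renewal_integral[OF S(2)[OF that] t u[OF that] v] unfolding u0[OF that] .
qed

lemma prob_space_exponential_mixture:
  assumes S: "finite S" "\<And>\<mu>. \<mu> \<in> S \<Longrightarrow> 0 < \<mu>" "\<And>\<mu>. \<mu> \<in> S \<Longrightarrow> 0 \<le> w \<mu>" and w: "sum w S = 1"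
  shows "prob_space (duration_law (exponential_mixture S w))"
proof
  have "has_bochner_integral (duration_law (exponential_mixture S w)) (\<lambda>x. 1::real) (\<Sum>\<mu>\<in>S. w \<mu> *\<^sub>R 1)"
    using prob_space.prob_space[OF prob_space_exponential_law]
      prob_space.finite_measure[OF prob_space_exponential_law]
    by (intro has_bochner_integral_exponential_mixture S)
      (auto simp: has_bochner_integral_iff S finite_measure.integrable_const)
  then have "integrable (duration_law (exponential_mixture S w)) (\<lambda>x. 1::real)"
    "(\<integral>x. (1::real) \<partial>duration_law (exponential_mixture S w)) = 1"
    using w by (auto simp: has_bochner_integral_iff)
  then show "emeasure (duration_law (exponential_mixture S w)) (space (duration_law (exponential_mixture S w))) = 1"
    by (subst emeasure_eq_ennreal_measure) (auto simp: integrable_iff_bounded)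
qed

lemma AE_exponential_mixture_nonneg: "AE x in duration_law (exponential_mixture S w). 0 \<le> x"
proof -
  have "exponential_mixture S w x = 0" if "x < 0" for x
    using that by (simp add: exponential_mixture_def exponential_density_def)
  then show ?thesis
    unfolding duration_law_def by (subst AE_density) (auto intro!: AE_I2 simp: not_less[symmetric])
qed

section \<open>Tail, mean and residual law of a mixture\<close>

lemma measure_exponential_law_atMost_less_1:
  assumes "0 < k" shows "measure (duration_law (exponential_density k)) {..T} < 1"
  using assms by (simp add: duration_law_def measure_def emeasure_erlang_density erlang_CDF_0)

lemma mean_exponential_mixture:
  assumes S: "finite S" "\<And>\<mu>. \<mu> \<in> S \<Longrightarrow> 0 < \<mu>" "\<And>\<mu>. \<mu> \<in> S \<Longrightarrow> 0 \<le> w \<mu>"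
  shows "mean_duration (exponential_mixture S w) = (\<Sum>\<mu>\<in>S. w \<mu> / \<mu>)"
proof -
  have "has_bochner_integral (duration_law (exponential_density \<mu>)) (\<lambda>x. x) (1 / \<mu>)" if "\<mu> \<in> S" for \<mu>
  proof -
    have \<mu>: "0 < \<mu>" using S that by auto
    interpret P: prob_space "duration_law (exponential_density \<mu>)" by (rule prob_space_exponential_law[OF \<mu>])
    have "distributed (duration_law (exponential_density \<mu>)) lborel (\<lambda>x. x) (exponential_density \<mu>)"
      by (simp add: distributed_def duration_law_def distr_id2)
    from P.exponential_distributed_expectation[OF \<mu> this]
    have "(\<integral>x. x \<partial>duration_law (exponential_density \<mu>)) = 1 / \<mu>" .
    \<comment> \<open>Integrability is read off the value: a non-integrable function would have
      integral 0, not 1/\<mu>.\<close>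
    then show ?thesis
      using \<mu> not_integrable_integral_eq by (fastforce simp: has_bochner_integral_iff)
  qed
  then have "has_bochner_integral (duration_law (exponential_mixture S w)) (\<lambda>x. x) (\<Sum>\<mu>\<in>S. w \<mu> *\<^sub>R (1 / \<mu>))"
    by (intro has_bochner_integral_exponential_mixture S) auto
  then show ?thesis by (simp add: mean_duration_def has_bochner_integral_iff)
qed

text \<open>The renewal integral with v = 0 and initial value 1 is the mass beyond t, and exp(-\<mu>
  x) solves the corresponding ODE. The endpoint t is a null set.\<close>

lemma measure_exponential_mixture_atLeast:
  assumes S: "finite S" "\<And>\<mu>. \<mu> \<in> S \<Longrightarrow> 0 < \<mu>" "\<And>\<mu>. \<mu> \<in> S \<Longrightarrow> 0 \<le> w \<mu>" and t: "0 \<le> t"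
  shows "measure (duration_law (exponential_mixture S w)) {t..} = (\<Sum>\<mu>\<in>S. w \<mu> * exp (- t * \<mu>))"
proof -
  let ?M = "duration_law (exponential_mixture S w)"
  have "has_bochner_integral ?M (\<lambda>x. if x \<le> t then 0 else (1::complex)) (\<Sum>\<mu>\<in>S. w \<mu> *\<^sub>R of_real (exp (- t * \<mu>)))"
  proof (rule exponential_mixture_renewal_integral[OF S t])
    fix \<mu> x
    have "((\<lambda>x. exp (- x * \<mu>)) has_real_derivative \<mu> * (0 - exp (- x * \<mu>))) (at x)"
      by (auto intro!: derivative_eq_intros)
    from has_vector_derivative_of_real[OF this]
    show "((\<lambda>x. complex_of_real (exp (- x * \<mu>))) has_vector_derivative
       complex_of_real \<mu> * (0 - complex_of_real (exp (- x * \<mu>)))) (at x)" by simp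
  qed auto
  then have "(\<integral>x. (if x \<le> t then 0 else (1::complex)) \<partial>?M) = of_real (\<Sum>\<mu>\<in>S. w \<mu> * exp (- t * \<mu>))"
    by (simp add: has_bochner_integral_iff scaleR_conv_of_real)
  also have "(\<lambda>x. if x \<le> t then 0 else (1::complex)) = (\<lambda>x. of_real (indicator {t<..} x))"
    by (auto simp: fun_eq_iff)
  finally have "measure ?M {t<..} = (\<Sum>\<mu>\<in>S. w \<mu> * exp (- t * \<mu>))"
    by (simp only: integral_complex_of_real of_real_eq_iff) simp
  moreover have "AE x in ?M. x \<in> {t..} \<longleftrightarrow> x \<in> {t<..}"
    unfolding duration_law_def using AE_lborel_singleton[of t] by (subst AE_density) (auto elim!: eventually_mono)
  then have "measure ?M {t..} = measure ?M {t<..}" by (intro measure_eq_AE) auto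
  ultimately show ?thesis by simp
qed

text \<open>The tail of an exponential law is its density divided by its rate, so the residual law
  keeps the rates and divides each weight by the rate.\<close>

lemma residual_exponential_mixture:
  assumes S: "finite S" "\<And>\<mu>. \<mu> \<in> S \<Longrightarrow> 0 < \<mu>" "\<And>\<mu>. \<mu> \<in> S \<Longrightarrow> 0 \<le> w \<mu>"
  shows "residual_density (exponential_mixture S w) =
    exponential_mixture S (\<lambda>\<mu>. w \<mu> / (\<mu> * mean_duration (exponential_mixture S w)))"
proof
  fix t :: real
  show "residual_density (exponential_mixture S w) t =
    exponential_mixture S (\<lambda>\<mu>. w \<mu> / (\<mu> * mean_duration (exponential_mixture S w))) t"
  proof (cases "t < 0")
    case True
    then show ?thesis by (simp add: residual_density_def exponential_mixture_def exponential_density_def)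
  next
    case False
    then have "residual_density (exponential_mixture S w) t =
       (\<Sum>\<mu>\<in>S. w \<mu> * exp (- t * \<mu>)) / mean_duration (exponential_mixture S w)"
      using measure_exponential_mixture_atLeast[OF S, where t = t] by (simp add: residual_density_def)
    also have "\<dots> = exponential_mixture S (\<lambda>\<mu>. w \<mu> / (\<mu> * mean_duration (exponential_mixture S w))) t"
      unfolding exponential_mixture_def sum_divide_distrib
    proof (rule sum.cong)
      fix \<mu> assume "\<mu> \<in> S"
      then have "\<mu> \<noteq> 0" using S(2) by force
      then show "w \<mu> * exp (- t * \<mu>) / mean_duration (\<lambda>x. \<Sum>\<mu>\<in>S. w \<mu> * exponential_density \<mu> x) =
        w \<mu> / (\<mu> * mean_duration (\<lambda>x. \<Sum>\<mu>\<in>S. w \<mu> * exponential_density \<mu> x)) * exponential_density \<mu> t"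
        using False by (simp add: exponential_density_def)
    qed simp
    finally show ?thesis .
  qed
qed

section \<open>Sums of residues\<close>

text \<open>The sum of the residues of \<open>M(s) e\<^sup>s\<^sup>t / Q(s)\<close> when all roots of \<open>Q\<close> are simple.\<close>

definition residue_sum :: "complex poly \<Rightarrow> complex poly \<Rightarrow> real \<Rightarrow> complex" where
  "residue_sum Q M t = (\<Sum>z | poly Q z = 0. poly M z * exp (z * of_real t) / poly (pderiv Q) z)"

lemma residue_sum_add: "residue_sum Q (A + B) t = residue_sum Q A t + residue_sum Q B t"
  by (simp add: residue_sum_def add_divide_distrib ring_distribs sum.distrib)

lemma residue_sum_diff: "residue_sum Q (A - B) t = residue_sum Q A t - residue_sum Q B t"
  by (simp add: residue_sum_def diff_divide_distrib ring_distribs sum_subtractf)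

lemma residue_sum_smult: "residue_sum Q (smult c A) t = c * residue_sum Q A t"
  by (simp add: residue_sum_def sum_distrib_left mult_ac)

lemma residue_sum_sum: "residue_sum Q (\<Sum>i\<in>I. A i) t = (\<Sum>i\<in>I. residue_sum Q (A i) t)"
proof (induction I rule: infinite_finite_induct)
  case (insert i I)
  then show ?case by (simp add: residue_sum_add)
qed (simp_all add: residue_sum_def)

lemma residue_sum_self: "residue_sum Q Q t = 0"
  by (simp add: residue_sum_def)

lemma has_vector_derivative_residue_sum:
  "(residue_sum Q M has_vector_derivative residue_sum Q ([:0, 1:] * M) t) (at t)"
proof -
  have "((\<lambda>t. poly M z * exp (z * of_real t) / poly (pderiv Q) z) has_vector_derivative
      poly ([:0, 1:] * M) z * exp (z * of_real t) / poly (pderiv Q) z) (at t)" for z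
  proof -
    have "((\<lambda>s. poly M z * exp (z * s) / poly (pderiv Q) z) has_field_derivative
        poly M z * (exp (z * of_real t) * z) / poly (pderiv Q) z) (at (of_real t))"
      by (auto intro!: derivative_eq_intros DERIV_cdivide)
    from has_vector_derivative_real_field[OF this] show ?thesis by (simp add: mult_ac)
  qed
  then show ?thesis
    unfolding residue_sum_def[abs_def] by (intro has_vector_derivative_sum)
qed

lemma continuous_on_residue_sum: "continuous_on A (residue_sum Q M)"
  using has_vector_derivative_residue_sum
  by (meson continuous_at_imp_continuous_on has_vector_derivative_continuous)

section \<open>Interpolation and partial fractions at simple roots\<close>

locale simple_roots =
  fixes Q :: "complex poly"
  assumes monic: "lead_coeff Q = 1" and simple: "rsquarefree Q"
begin

abbreviation "Z \<equiv> {z. poly Q z = 0}"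

lemma Q_nz: "Q \<noteq> 0" using monic by auto

lemma finite_Z [simp]: "finite Z"
  using Q_nz by (rule poly_roots_finite)

lemma Q_eq: "Q = (\<Prod>z\<in>Z. [:-z, 1:])"
  using complex_poly_decompose_rsquarefree[OF simple] monic by simp

lemma card_Z: "card Z = degree Q"
  by (subst (2) Q_eq) (simp add: degree_prod_sum_eq)

lemma poly_eq_prod: "poly Q s = (\<Prod>z\<in>Z. s - z)"
  by (subst Q_eq) (simp add: poly_prod)

lemma pderiv_Q:
  assumes "poly Q z = 0"
  shows "poly (pderiv Q) z = (\<Prod>w\<in>Z - {z}. z - w)"
proof -
  have "poly (pderiv Q) z = (\<Sum>a\<in>Z. \<Prod>w\<in>Z - {a}. z - w)"
    by (subst Q_eq) (simp add: pderiv_prod poly_sum poly_prod pderiv_pCons)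
  \<comment> \<open>Every other summand contains the factor z - z.\<close>
  also have "\<dots> = (\<Sum>a\<in>{z}. \<Prod>w\<in>Z - {a}. z - w)"
    using assms by (intro sum.mono_neutral_right) auto
  finally show ?thesis by simp
qed

lemma pderiv_Q_nz: "poly Q z = 0 \<Longrightarrow> poly (pderiv Q) z \<noteq> 0"
  using simple rsquarefree_roots by blast

text \<open>Both sides have degree below the number of roots and agree at each root, since
  \<open>pderiv_Q\<close> gives the value of the basis polynomial there.\<close>

lemma lagrange_interpolation:
  assumes M: "degree M < degree Q"
  shows "M = (\<Sum>z\<in>Z. smult (poly M z / poly (pderiv Q) z) (\<Prod>w\<in>Z - {z}. [:-w, 1:]))" (is "M = ?R")
proof (rule poly_eqI_degree[where A = Z])
  fix x assume x: "x \<in> Z"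
  have "poly ?R x = (\<Sum>z\<in>Z. poly M z / poly (pderiv Q) z * (\<Prod>w\<in>Z - {z}. x - w))"
    by (simp add: poly_sum poly_prod)
  also have "\<dots> = (\<Sum>z\<in>{x}. poly M z / poly (pderiv Q) z * (\<Prod>w\<in>Z - {z}. x - w))"
    using x by (intro sum.mono_neutral_right) auto
  also have "\<dots> = poly M x" using x pderiv_Q[of x] pderiv_Q_nz[of x] by simp
  finally show "poly M x = poly ?R x" by simp
next
  show "degree M < card Z" using M by (simp add: card_Z)
  have "degree ?R \<le> degree Q - 1"
  proof (rule degree_sum_le)
    fix z assume "z \<in> Z"
    then have "degree (\<Prod>w\<in>Z - {z}. [:-w, 1:]) = degree Q - 1"
      by (simp add: degree_prod_sum_eq card_Z)
    then show "degree (smult (poly M z / poly (pderiv Q) z) (\<Prod>w\<in>Z - {z}. [:-w, 1:])) \<le> degree Q - 1"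
      using degree_smult_le by metis
  qed simp
  also have "\<dots> < card Z" using M by (simp add: card_Z)
  finally show "degree ?R < card Z" .
qed

text \<open>The initial value theorem: the coefficient is the limit of s M(s) / Q(s) at infinity. It
  appears by comparing top coefficients in the interpolation formula, whose basis polynomials are
  monic of degree \<open>degree Q - 1\<close>.\<close>

lemma residue_sum_0:
  assumes M: "degree M < degree Q"
  shows "residue_sum Q M 0 = coeff M (degree Q - 1)"
proof -
  have "coeff (\<Prod>w\<in>Z - {z}. [:-w, 1:]) (degree Q - 1) = 1" if "z \<in> Z" for z
  proof -
    have "degree (\<Prod>w\<in>Z - {z}. [:-w, 1:]) = degree Q - 1"
      using that by (simp add: degree_prod_sum_eq card_Z)
    then show ?thesis using lead_coeff_prod[of "\<lambda>w. [:-w, 1:]" "Z - {z}"] by simp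
  qed
  then show ?thesis
    by (subst (2) lagrange_interpolation[OF M]) (simp add: residue_sum_def coeff_sum)
qed

text \<open>The interpolation formula divided by Q. It resums the transforms of the single
  exponentials.\<close>

lemma partial_fractions:
  assumes M: "degree M < degree Q" and s: "poly Q s \<noteq> 0"
  shows "poly M s / poly Q s = (\<Sum>z\<in>Z. poly M z / poly (pderiv Q) z / (s - z))"
proof -
  have "(\<Prod>w\<in>Z - {z}. s - w) / poly Q s = 1 / (s - z)" if "z \<in> Z" for z
  proof -
    have eq: "poly Q s = (s - z) * (\<Prod>w\<in>Z - {z}. s - w)"
      using poly_eq_prod[of s] prod.remove[OF finite_Z that, of "\<lambda>w. s - w"] by (rule trans)
    have "s - z \<noteq> 0" using s that by auto
    moreover have "(\<Prod>w\<in>Z - {z}. s - w) \<noteq> 0" using s eq by (metis mult_zero_right)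
    ultimately show ?thesis unfolding eq by simp
  qed
  then have "(\<Sum>z\<in>Z. poly M z / poly (pderiv Q) z / (s - z)) =
      (\<Sum>z\<in>Z. poly M z / poly (pderiv Q) z * ((\<Prod>w\<in>Z - {z}. s - w) / poly Q s))"
    by (intro sum.cong) auto
  also have "\<dots> = poly (\<Sum>z\<in>Z. smult (poly M z / poly (pderiv Q) z) (\<Prod>w\<in>Z - {z}. [:-w, 1:])) s / poly Q s"
    by (simp add: poly_sum poly_prod sum_divide_distrib)
  also have "\<dots> = poly M s / poly Q s"
    by (simp only: lagrange_interpolation[OF M, symmetric])
  finally show ?thesis by simp
qed

end

section \<open>Numerators and denominator for distinct OFF rates\<close>

locale hyperexponential_channel =
  fixes S :: "real set" and q :: "real \<Rightarrow> real" and l :: real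
  assumes finite_S [simp]: "finite S" and S_pos: "\<And>\<mu>. \<mu> \<in> S \<Longrightarrow> 0 < \<mu>"
    and q_pos: "\<And>\<mu>. \<mu> \<in> S \<Longrightarrow> 0 < q \<mu>" and q_sum: "sum q S = 1" and l_pos: "0 < l"
begin

definition cofactor :: "real \<Rightarrow> complex poly" where
  "cofactor \<mu> = (\<Prod>\<nu>\<in>S - {\<mu>}. [:of_real \<nu>, 1:])"

definition full :: "complex poly" where
  "full = (\<Prod>\<nu>\<in>S. [:of_real \<nu>, 1:])"

text \<open>\<open>num\<close> and \<open>den\<close> play the roles of N and D after merging; N and
  D are their multiples by one common factor.\<close>

definition num :: "complex poly" where
  "num = (\<Sum>\<mu>\<in>S. smult (of_real (q \<mu>)) (cofactor \<mu>))"

definition den :: "complex poly" where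
  "den = full + smult (of_real l) num"

definition Q :: "complex poly" where
  "Q = [:0, 1:] * den"

lemma S_ne: "S \<noteq> {}" using q_sum by auto

lemma card_S_pos: "0 < card S" using S_ne by (simp add: card_gt_0_iff)

lemma full_eq: "\<mu> \<in> S \<Longrightarrow> full = [:of_real \<mu>, 1:] * cofactor \<mu>"
  unfolding full_def cofactor_def by (subst prod.remove[of S \<mu>]) auto

lemma degree_full: "degree full = card S"
  by (simp add: full_def degree_prod_sum_eq)

lemma degree_cofactor: "\<mu> \<in> S \<Longrightarrow> degree (cofactor \<mu>) = card S - 1"
  by (simp add: cofactor_def degree_prod_sum_eq)

lemma coeff_cofactor: "\<mu> \<in> S \<Longrightarrow> coeff (cofactor \<mu>) (card S - 1) = 1"
  using lead_coeff_prod[of "\<lambda>\<nu>. [:complex_of_real \<nu>, 1:]" "S - {\<mu>}"] degree_cofactor[of \<mu>]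
  by (simp add: cofactor_def)

lemma degree_num: "degree num < card S"
proof -
  have "degree num \<le> card S - 1"
    unfolding num_def by (rule degree_sum_le) (auto simp: degree_cofactor intro: order_trans[OF degree_smult_le])
  then show ?thesis using card_S_pos by linarith
qed

lemma degree_smult_num: "degree (smult c num) < card S"
  using degree_num degree_smult_le le_less_trans by blast

lemma degree_den: "degree den = card S"
  unfolding den_def by (subst degree_add_eq_left) (use degree_smult_num[of "of_real l"] in \<open>auto simp: degree_full\<close>)

lemma lead_coeff_den: "lead_coeff den = 1"
proof -
  have "coeff (smult (of_real l) num) (card S) = 0" by (rule coeff_eq_0[OF degree_smult_num])
  moreover have "coeff full (card S) = 1"
    using lead_coeff_prod[of "\<lambda>\<nu>. [:complex_of_real \<nu>, 1:]" S] degree_full by (simp add: full_def)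
  ultimately show ?thesis by (simp only: degree_den) (simp only: den_def coeff_add add_0_right)
qed

lemma den_nz [simp]: "den \<noteq> 0" using lead_coeff_den by auto

lemma poly_full_nz: "z \<notin> (\<lambda>\<mu>. - of_real \<mu>) ` S \<Longrightarrow> poly full z \<noteq> 0"
  by (auto simp: full_def poly_prod image_iff) (metis add.commute add_eq_0_iff)

text \<open>The sum of the q \<mu> / (z + \<mu>) is the Laplace transform of the tail of the OFF
  law, which is where the numerator comes from.\<close>

lemma poly_num:
  assumes "z \<notin> (\<lambda>\<mu>. - of_real \<mu>) ` S"
  shows "poly num z = poly full z * (\<Sum>\<mu>\<in>S. of_real (q \<mu>) / (z + of_real \<mu>))"
proof -
  have "poly (cofactor \<mu>) z = poly full z / (z + of_real \<mu>)" if "\<mu> \<in> S" for \<mu>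
  proof -
    have "z + of_real \<mu> \<noteq> 0" using assms that by (auto simp: image_iff add_eq_0_iff2)
    then show ?thesis using full_eq[OF that] by (simp add: distrib_right[symmetric] add.commute)
  qed
  then show ?thesis by (simp add: num_def poly_sum sum_distrib_left mult_ac)
qed

lemma poly_den:
  assumes "z \<notin> (\<lambda>\<mu>. - of_real \<mu>) ` S"
  shows "poly den z = poly full z * (1 + of_real l * (\<Sum>\<mu>\<in>S. of_real (q \<mu>) / (z + of_real \<mu>)))"
  using poly_num[OF assms] by (simp add: den_def ring_distribs)

text \<open>At -\<mu> only the summand of \<open>num\<close> that omits the factor of \<mu>
  survives, and its weight is positive.\<close>

lemma poly_den_at_rate:
  assumes "\<mu> \<in> S"
  shows "poly den (- of_real \<mu>) \<noteq> 0"
proof -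
  have "poly (cofactor \<nu>) (- of_real \<mu>) = 0" if "\<nu> \<in> S - {\<mu>}" for \<nu>
    using assms that by (auto simp: cofactor_def poly_prod)
  then have "poly num (- of_real \<mu>) = of_real (q \<mu>) * poly (cofactor \<mu>) (- of_real \<mu>)"
    using assms by (simp add: num_def poly_sum sum.remove[of S \<mu>])
  moreover have "poly (cofactor \<mu>) (- of_real \<mu>) \<noteq> 0"
    by (auto simp: cofactor_def poly_prod)
  moreover have "poly full (- of_real \<mu>) = 0" using full_eq[OF assms] by simp
  ultimately show ?thesis using q_pos[OF assms] l_pos by (simp add: den_def)
qed

lemma den_root:
  assumes z: "poly den z = 0"
  shows "z \<notin> (\<lambda>\<mu>. - of_real \<mu>) ` S" "Im z = 0" "Re z < 0" "poly (pderiv den) z \<noteq> 0"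
proof -
  \<comment> \<open>Off the poles \<open>den = full * h\<close>, and \<open>q \<ge> 0\<close> forces roots of \<open>h\<close> to be real and simple.\<close>
  let ?h = "\<lambda>z. 1 + of_real l * (\<Sum>\<mu>\<in>S. of_real (q \<mu>) / (z + of_real \<mu>)) :: complex"
  let ?h' = "- of_real l * (\<Sum>\<mu>\<in>S. of_real (q \<mu>) / (z + of_real \<mu>)\<^sup>2) :: complex"
  show out: "z \<notin> (\<lambda>\<mu>. - of_real \<mu>) ` S" using z poly_den_at_rate by auto
  have nz: "z + of_real \<mu> \<noteq> 0" if "\<mu> \<in> S" for \<mu>
    using out that by (auto simp: image_iff add_eq_0_iff2)
  have h0: "?h z = 0" using z poly_den[OF out] poly_full_nz[OF out] by simp
  show im: "Im z = 0"
  proof (rule ccontr)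
    assume im: "Im z \<noteq> 0"
    \<comment> \<open>Each term has an imaginary part of sign opposite to Im z, so the terms cannot
      cancel.\<close>
    have "0 = Im (?h z)" using h0 by simp
    also have "\<dots> = l * (\<Sum>\<mu>\<in>S. q \<mu> * (- Im z / ((Re z + \<mu>)\<^sup>2 + (Im z)\<^sup>2)))"
      by (simp add: Im_divide)
    also have "\<dots> = - (l * Im z * (\<Sum>\<mu>\<in>S. q \<mu> / ((Re z + \<mu>)\<^sup>2 + (Im z)\<^sup>2)))"
      by (simp add: sum_distrib_left sum_negf mult_ac)
    finally have "(\<Sum>\<mu>\<in>S. q \<mu> / ((Re z + \<mu>)\<^sup>2 + (Im z)\<^sup>2)) = 0" using im l_pos by simp
    moreover have "(\<Sum>\<mu>\<in>S. q \<mu> / ((Re z + \<mu>)\<^sup>2 + (Im z)\<^sup>2)) > 0"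
      using im by (intro sum_pos divide_pos_pos q_pos S_ne sum_power2_gt_zero_iff[THEN iffD2]) auto
    ultimately show False by simp
  qed
  define x where "x = Re z"
  have zx: "z = of_real x" using im by (simp add: x_def complex_eq_iff)
  show "Re z < 0"
  proof (rule ccontr)
    assume "\<not> Re z < 0"
    then have "0 < 1 + l * (\<Sum>\<mu>\<in>S. q \<mu> / (x + \<mu>))"
      using l_pos by (intro add_pos_nonneg mult_nonneg_nonneg sum_nonneg divide_nonneg_nonneg)
        (auto simp: x_def less_imp_le[OF q_pos] dest: S_pos)
    moreover have "of_real (1 + l * (\<Sum>\<mu>\<in>S. q \<mu> / (x + \<mu>))) = ?h z" by (simp add: zx)
    then have "1 + l * (\<Sum>\<mu>\<in>S. q \<mu> / (x + \<mu>)) = 0"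
      using h0 by (metis of_real_eq_0_iff)
    ultimately show False by simp
  qed
  have "(?h has_field_derivative ?h') (at z)"
    using nz by (auto intro!: derivative_eq_intros simp: power2_eq_square sum_negf)
  then have "((\<lambda>z. poly full z * ?h z) has_field_derivative poly (pderiv full) z * ?h z + ?h' * poly full z) (at z)"
    by (intro DERIV_mult poly_DERIV)
  \<comment> \<open>The factorisation holds only off the poles, so it is differentiated on a
    neighbourhood that avoids this finite set.\<close>
  moreover have "\<forall>\<^sub>F w in nhds z. w \<in> - (\<lambda>\<mu>. - of_real \<mu>) ` S"
    using out by (intro eventually_nhds_in_open open_Compl finite_imp_closed) auto
  then have "\<forall>\<^sub>F w in nhds z. poly den w = poly full w * ?h w"
    by eventually_elim (simp add: poly_den)
  ultimately have "(poly den has_field_derivative poly (pderiv full) z * ?h z + ?h' * poly full z) (at z)"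
    by (subst DERIV_cong_ev[OF refl _ refl]) auto
  then have "poly (pderiv den) z = ?h' * poly full z"
    using h0 DERIV_unique[OF poly_DERIV] by fastforce
  \<comment> \<open>As z is real, the sum in \<open>?h'\<close> consists of positive terms.\<close>
  moreover have "?h' \<noteq> 0"
  proof -
    have "(\<Sum>\<mu>\<in>S. q \<mu> / (x + \<mu>)\<^sup>2) > 0"
      using nz by (intro sum_pos divide_pos_pos q_pos S_ne) (auto simp: zx simp flip: of_real_add)
    moreover have "?h' = of_real (- l * (\<Sum>\<mu>\<in>S. q \<mu> / (x + \<mu>)\<^sup>2))" by (simp add: zx)
    moreover have "- l * (\<Sum>\<mu>\<in>S. q \<mu> / (x + \<mu>)\<^sup>2) \<noteq> 0" using calculation(1) l_pos by simp
    ultimately show ?thesis by (simp only: of_real_eq_0_iff) simp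
  qed
  ultimately show "poly (pderiv den) z \<noteq> 0" using poly_full_nz[OF out] by simp
qed

lemma den_0_nz: "poly den 0 \<noteq> 0" using den_root(3)[of 0] by auto

lemma poly_Q: "poly Q z = z * poly den z" by (simp add: Q_def)

lemma poly_pderiv_Q: "poly (pderiv Q) z = poly den z + z * poly (pderiv den) z"
  by (simp add: Q_def pderiv_mult pderiv_pCons)

lemma degree_Q: "degree Q = Suc (card S)"
  by (simp add: Q_def degree_mult_eq degree_den)

text \<open>The factor s adds the root 0 to the simple roots of \<open>den\<close>, which are
  negative. Hence Q' = den + s den' vanishes at none of them.\<close>

sublocale simple_roots Q
proof
  show "lead_coeff Q = 1" using lead_coeff_den by (simp add: Q_def lead_coeff_mult del: mult_pCons_left)
  show "rsquarefree Q"
    using den_root(4) den_0_nz by (auto simp: rsquarefree_roots poly_Q poly_pderiv_Q)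
qed

lemma Z_eq: "Z = insert 0 {z. poly den z = 0}" by (auto simp: poly_Q)

text \<open>den / Q = 1/s has the single residue 1, at 0.\<close>

lemma residue_sum_den: "residue_sum Q den t = 1"
  using den_0_nz poly_roots_finite[OF den_nz] by (simp add: residue_sum_def Z_eq poly_pderiv_Q)

text \<open>\<open>state_num \<mu> / Q\<close> is the Laplace transform of the probability of being OFF for a channel that
  starts an OFF period of rate \<open>\<mu>\<close>; \<open>l num / Q\<close> is that of a channel that starts an ON period.\<close>

definition state_num :: "real \<Rightarrow> complex poly" where
  "state_num \<mu> = [:0, 1:] * cofactor \<mu> + smult (of_real l) num"

lemma degree_state_num: "\<mu> \<in> S \<Longrightarrow> degree (state_num \<mu>) < degree Q"
  using degree_smult_num[of "of_real l"] card_S_pos degree_mult_le[of "[:0, 1:]" "cofactor \<mu>"]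
  unfolding state_num_def degree_Q
  by (intro degree_add_less) (auto simp: degree_cofactor simp del: mult_pCons_left)

lemma residue_state_num_0: "\<mu> \<in> S \<Longrightarrow> residue_sum Q (state_num \<mu>) 0 = 1"
  using card_S_pos coeff_cofactor[of \<mu>] coeff_eq_0[OF degree_num]
  by (subst residue_sum_0[OF degree_state_num]) (auto simp: degree_Q state_num_def coeff_pCons split: nat.split)

lemma residue_num_0: "residue_sum Q num 0 = 0"
  using degree_num by (subst residue_sum_0) (auto simp: degree_Q coeff_eq_0)

lemma state_num_ode:
  assumes "\<mu> \<in> S"
  shows "(residue_sum Q (state_num \<mu>) has_vector_derivative
    of_real \<mu> * (of_real l * residue_sum Q num t - residue_sum Q (state_num \<mu>) t)) (at t)"
proof -
  \<comment> \<open>This is s a = 1 + \<mu> (b - a) multiplied by Q; the initial value 1 has become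
    the term Q, which has no residues.\<close>
  have "[:0, 1:] * state_num \<mu> = Q + smult (of_real \<mu>) (smult (of_real l) num - state_num \<mu>)"
    by (simp add: state_num_def Q_def den_def full_eq[OF assms] algebra_simps smult_add_right)
  then show ?thesis
    using has_vector_derivative_residue_sum[of Q "state_num \<mu>" t]
    by (simp only: residue_sum_add residue_sum_diff residue_sum_smult residue_sum_self) simp
qed

lemma num_ode:
  "((\<lambda>t. of_real l * residue_sum Q num t) has_vector_derivative
    of_real l * ((\<Sum>\<mu>\<in>S. q \<mu> *\<^sub>R residue_sum Q (state_num \<mu>) t) - of_real l * residue_sum Q num t)) (at t)"
proof -
  \<comment> \<open>Up to the factor l, this leads to s b = l (sum q a - b) multiplied by Q, with
    initial value 0.\<close>
  have "(\<Sum>\<mu>\<in>S. smult (of_real (q \<mu>)) (state_num \<mu>)) =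
      [:0, 1:] * num + (\<Sum>\<mu>\<in>S. smult (of_real (q \<mu>)) (smult (of_real l) num))"
    by (simp add: state_num_def num_def smult_add_right sum.distrib sum_distrib_left del: mult_pCons_left)
  also have "(\<Sum>\<mu>\<in>S. smult (of_real (q \<mu>)) (smult (of_real l) num)) = smult (of_real l) num"
    using q_sum by (simp flip: smult_sum of_real_sum sum_distrib_right)
  finally have "[:0, 1:] * num = (\<Sum>\<mu>\<in>S. smult (of_real (q \<mu>)) (state_num \<mu>)) - smult (of_real l) num"
    by simp
  then have "residue_sum Q ([:0, 1:] * num) t =
      (\<Sum>\<mu>\<in>S. q \<mu> *\<^sub>R residue_sum Q (state_num \<mu>) t) - of_real l * residue_sum Q num t"
    by (simp only: residue_sum_diff residue_sum_sum residue_sum_smult scaleR_conv_of_real)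
  then show ?thesis
    using has_vector_derivative_mult_right[OF has_vector_derivative_residue_sum[of Q num t], of "of_real l"]
    by simp
qed

text \<open>den - state_num \<mu> equals \<mu> times \<open>cofactor\<close> \<mu>, so the weights q
  \<mu> / \<mu> of the residual law reassemble exactly \<open>num\<close>.\<close>

lemma sum_state_num:
  "(\<Sum>\<mu>\<in>S. (q \<mu> / \<mu>) *\<^sub>R residue_sum Q (state_num \<mu>) t) = of_real (\<Sum>\<mu>\<in>S. q \<mu> / \<mu>) - residue_sum Q num t"
proof -
  have "smult (of_real (q \<mu> / \<mu>)) (state_num \<mu>) =
      smult (of_real (q \<mu> / \<mu>)) den - smult (of_real (q \<mu>)) (cofactor \<mu>)" if "\<mu> \<in> S" for \<mu>
    using S_pos[OF that] by (simp add: state_num_def den_def full_eq[OF that] smult_add_right algebra_simps)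
  then have "(\<Sum>\<mu>\<in>S. smult (of_real (q \<mu> / \<mu>)) (state_num \<mu>)) = (\<Sum>\<mu>\<in>S. smult (of_real (q \<mu> / \<mu>)) den) - num"
    by (simp add: sum_subtractf num_def)
  then have "residue_sum Q (\<Sum>\<mu>\<in>S. smult (of_real (q \<mu> / \<mu>)) (state_num \<mu>)) t =
      residue_sum Q ((\<Sum>\<mu>\<in>S. smult (of_real (q \<mu> / \<mu>)) den) - num) t" by simp
  then show ?thesis
    by (simp only: residue_sum_diff residue_sum_sum residue_sum_smult residue_sum_den scaleR_conv_of_real) simp
qed

end

section \<open>Solution of the renewal equations\<close>

definition alternating :: "real measure \<Rightarrow> real measure \<Rightarrow> nat \<Rightarrow> real measure" where
  "alternating F G k = (if even k then F else G)"

lemma renewal_sequence_alternating: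
  assumes "prob_space F" "sets F = sets borel" "AE x in F. 0 \<le> x"
    and "prob_space G" "sets G = sets borel" "AE x in G. 0 \<le> x"
  shows "renewal_sequence (alternating F G)"
  unfolding renewal_sequence_def alternating_def using assms by auto

lemma alternating_0 [simp]: "alternating F G 0 = F"
  by (simp add: alternating_def)

lemma alternating_Suc: "(\<lambda>i. alternating F G (Suc i)) = alternating G F"
  by (auto simp: alternating_def)

lemma (in renewal_sequence) integrable_renewal:
  "integrable (M i) (\<lambda>x. if x \<le> t then complex_of_real (parity_prob M par (t - x)) else c)"
proof -
  interpret Mi: prob_space "M i" by (rule prob)
  show ?thesis
  proof (rule Mi.integrable_const_bound[where B = "max 1 (norm c)"])
    show "AE x in M i. norm (if x \<le> t then complex_of_real (parity_prob M par (t - x)) else c) \<le> max 1 (norm c)"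
      using parity_prob_bounds by (auto intro!: AE_I2 max.coboundedI1)
    show "(\<lambda>x. if x \<le> t then complex_of_real (parity_prob M par (t - x)) else c) \<in> borel_measurable (M i)"
      by (subst measurable_cong_sets[OF sets_M refl]) measurable
  qed
qed

lemma (in renewal_sequence) parity_prob_renewal_complex:
  assumes "0 \<le> t"
  shows "complex_of_real (parity_prob M par t) =
    (\<integral>x. (if x \<le> t then complex_of_real (parity_prob (\<lambda>i. M (Suc i)) (\<not> par) (t - x)) else of_bool par) \<partial>M 0)"
proof -
  have "complex_of_real (parity_prob M par t) = (\<integral>x. complex_of_real (if x \<le> t then parity_prob (\<lambda>i. M (Suc i)) (\<not> par) (t - x) else of_bool par) \<partial>M 0)"
    by (subst parity_prob_renewal[OF assms]) simp
  also have "(\<lambda>x. complex_of_real (if x \<le> t then parity_prob (\<lambda>i. M (Suc i)) (\<not> par) (t - x) else of_bool par)) =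
    (\<lambda>x. if x \<le> t then complex_of_real (parity_prob (\<lambda>i. M (Suc i)) (\<not> par) (t - x)) else of_bool par)"
    by auto
  finally show ?thesis .
qed

context hyperexponential_channel
begin

abbreviation "Y \<equiv> duration_law (exponential_mixture S q)"
abbreviation "X \<equiv> duration_law (exponential_density l)"

lemma q_nonneg: "\<mu> \<in> S \<Longrightarrow> 0 \<le> q \<mu>" using q_pos by force

lemma Y: "prob_space Y" "sets Y = sets borel" "AE x in Y. 0 \<le> x"
  using prob_space_exponential_mixture[OF finite_S S_pos q_nonneg q_sum] AE_exponential_mixture_nonneg by auto

lemma exponential_density_eq_mixture: "exponential_density k = exponential_mixture {k} (\<lambda>_. 1)"
  by (simp add: exponential_mixture_def fun_eq_iff)

lemma X: "prob_space X" "sets X = sets borel" "AE x in X. 0 \<le> x"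
  using prob_space_exponential_law[OF l_pos] AE_exponential_mixture_nonneg[of "{l}" "\<lambda>_. 1"]
  unfolding exponential_density_eq_mixture by auto

lemma parity_prob_eq_ode_solution:
  fixes U :: "real \<Rightarrow> real \<Rightarrow> complex" and V :: "real \<Rightarrow> complex"
  assumes U: "\<And>\<mu> x. \<mu> \<in> S \<Longrightarrow> (U \<mu> has_vector_derivative of_real \<mu> * (V x - U \<mu> x)) (at x)"
    and V: "\<And>x. (V has_vector_derivative of_real l * ((\<Sum>\<mu>\<in>S. q \<mu> *\<^sub>R U \<mu> x) - V x)) (at x)"
    and U0: "\<And>\<mu>. \<mu> \<in> S \<Longrightarrow> U \<mu> 0 = of_bool par" and V0: "V 0 = of_bool (\<not> par)"
    and t: "0 \<le> t"
  shows "of_real (parity_prob (alternating Y X) par t) = (\<Sum>\<mu>\<in>S. q \<mu> *\<^sub>R U \<mu> t)"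
    and "of_real (parity_prob (alternating X Y) (\<not> par) t) = V t"
proof -
  define W where "W t = (\<Sum>\<mu>\<in>S. q \<mu> *\<^sub>R U \<mu> t)" for t
  interpret YX: renewal_sequence "alternating Y X" by (rule renewal_sequence_alternating[OF Y X])
  interpret XY: renewal_sequence "alternating X Y" by (rule renewal_sequence_alternating[OF X Y])
  let ?a = "\<lambda>t. complex_of_real (parity_prob (alternating Y X) par t)"
  let ?b = "\<lambda>t. complex_of_real (parity_prob (alternating X Y) (\<not> par) t)"
  have contV: "continuous_on A V" for A
    using V by (meson continuous_at_imp_continuous_on has_vector_derivative_continuous)
  have contU: "continuous_on A (U \<mu>)" if "\<mu> \<in> S" for \<mu> A
    using U[OF that] by (meson continuous_at_imp_continuous_on has_vector_derivative_continuous)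
  have contW: "continuous_on A W" for A
    unfolding W_def[abs_def] by (intro continuous_intros contU)
  have V': "(V has_vector_derivative of_real l * (W x - V x)) (at x)" for x
    using V[of x] by (simp add: W_def)
  have a_eq: "?a t = (\<integral>x. (if x \<le> t then ?b (t - x) else of_bool par) \<partial>Y)" if "0 \<le> t" for t
    using YX.parity_prob_renewal_complex[OF that, of par] unfolding alternating_Suc by simp
  have b_eq: "?b t = (\<integral>x. (if x \<le> t then ?a (t - x) else of_bool (\<not> par)) \<partial>X)" if "0 \<le> t" for t
    using XY.parity_prob_renewal_complex[OF that, of "\<not> par"] unfolding alternating_Suc not_not by simp
  have a_int: "integrable X (\<lambda>x. if x \<le> t then ?a (t - x) else c)" for t c
    using YX.integrable_renewal[of 1] by (simp add: alternating_def)
  have b_int: "integrable Y (\<lambda>x. if x \<le> t then ?b (t - x) else c)" for t c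
    using XY.integrable_renewal[of 1] by (simp add: alternating_def)
  have W_int: "has_bochner_integral Y (\<lambda>x. if x \<le> t then V (t - x) else of_bool par) (W t)" if "0 \<le> t" for t
    unfolding W_def
    by (rule exponential_mixture_renewal_integral[OF finite_S S_pos q_nonneg that U U0 contV])
  have V_int: "has_bochner_integral X (\<lambda>x. if x \<le> t then W (t - x) else of_bool (\<not> par)) (V t)" if "0 \<le> t" for t
    using exponential_renewal_integral[OF l_pos that V' contW] unfolding V0 .
  have "?b t - V t = 0" "?a t - W t = 0"
  proof -
    have b_diff: "?b t - V t = (\<integral>x. (if x \<le> t then ?a (t - x) - W (t - x) else 0) \<partial>X)" if "0 \<le> t" for t
    proof -
      have "?b t - V t = (\<integral>x. (if x \<le> t then ?a (t - x) else of_bool (\<not> par)) - (if x \<le> t then W (t - x) else of_bool (\<not> par)) \<partial>X)"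
        using V_int[OF that] by (subst Bochner_Integration.integral_diff[OF a_int]) (auto simp: has_bochner_integral_iff b_eq[OF that])
      also have "\<dots> = (\<integral>x. (if x \<le> t then ?a (t - x) - W (t - x) else 0) \<partial>X)"
        by (rule Bochner_Integration.integral_cong) auto
      finally show ?thesis .
    qed
    have a_diff: "?a t - W t = (\<integral>x. (if x \<le> t then ?b (t - x) - V (t - x) else 0) \<partial>Y)" if "0 \<le> t" for t
    proof -
      have "?a t - W t = (\<integral>x. (if x \<le> t then ?b (t - x) else of_bool par) - (if x \<le> t then V (t - x) else of_bool par) \<partial>Y)"
        using W_int[OF that] by (subst Bochner_Integration.integral_diff[OF b_int]) (auto simp: has_bochner_integral_iff a_eq[OF that])
      also have "\<dots> = (\<integral>x. (if x \<le> t then ?b (t - x) - V (t - x) else 0) \<partial>Y)"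
        by (rule Bochner_Integration.integral_cong) auto
      finally show ?thesis .
    qed
    have bounded: "\<exists>B. \<forall>s\<in>{0..T}. norm (?b s - V s) \<le> B" for T
    proof -
      have "bounded (V ` {0..T})" using contV compact_continuous_image compact_imp_bounded by blast
      then obtain B where B: "\<And>s. s \<in> {0..T} \<Longrightarrow> norm (V s) \<le> B" 
        unfolding bounded_iff by blast
      have "norm (?b s - V s) \<le> 1 + B" if "s \<in> {0..T}" for s
        using norm_triangle_ineq4[of "?b s" "V s"] B[OF that] XY.parity_prob_bounds[of "\<not> par" s] by simp
      then show ?thesis by blast
    qed
    show "?b t - V t = 0" "?a t - W t = 0"
      using renewal_equation_unique[OF X Y measure_exponential_law_atMost_less_1[OF l_pos] b_diff a_diff bounded t]
      by blast+
  qed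
  then show "?a t = (\<Sum>\<mu>\<in>S. q \<mu> *\<^sub>R U \<mu> t)" "?b t = V t" by (simp_all add: W_def)
qed

text \<open>Even periods of \<open>alternating X Y\<close> are ON periods, so parity \<open>False\<close> means OFF.\<close>

lemma parity_prob_off:
  assumes "0 \<le> t"
  shows "of_real (parity_prob (alternating X Y) False t) = of_real l * residue_sum Q num t"
proof -
  have "of_real (parity_prob (alternating X Y) (\<not> True) t) = of_real l * residue_sum Q num t"
    by (rule parity_prob_eq_ode_solution(2)[OF state_num_ode num_ode _ _ assms])
      (auto simp: residue_state_num_0 residue_num_0)
  then show ?thesis by simp
qed

text \<open>Complementing the event would require that the periods almost surely exhaust the time
  axis. Instead, 1 minus the solution solves the same system with exchanged initial values.\<close>

lemma parity_prob_on:
  assumes "0 \<le> t"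
  shows "of_real (parity_prob (alternating X Y) True t) = 1 - of_real l * residue_sum Q num t"
proof -
  let ?U = "\<lambda>\<mu> t. 1 - residue_sum Q (state_num \<mu>) t" and ?V = "\<lambda>t. 1 - of_real l * residue_sum Q num t"
  have W: "(\<Sum>\<mu>\<in>S. q \<mu> *\<^sub>R ?U \<mu> x) = 1 - (\<Sum>\<mu>\<in>S. q \<mu> *\<^sub>R residue_sum Q (state_num \<mu>) x)" for x
    using q_sum by (simp add: algebra_simps sum_subtractf scaleR_conv_of_real flip: of_real_sum)
  have "(?U \<mu> has_vector_derivative of_real \<mu> * (?V x - ?U \<mu> x)) (at x)" if "\<mu> \<in> S" for \<mu> x
    using has_vector_derivative_diff[OF has_vector_derivative_const state_num_ode[OF that], of 1 x]
    by (simp add: algebra_simps)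
  moreover have "(?V has_vector_derivative of_real l * ((\<Sum>\<mu>\<in>S. q \<mu> *\<^sub>R ?U \<mu> x) - ?V x)) (at x)" for x
    unfolding W using has_vector_derivative_diff[OF has_vector_derivative_const num_ode, of 1 x]
    by (simp add: algebra_simps)
  ultimately have "of_real (parity_prob (alternating X Y) (\<not> False) t) = ?V t"
    by (rule parity_prob_eq_ode_solution(2)[OF _ _ _ _ assms]) (auto simp: residue_state_num_0 residue_num_0)
  then show ?thesis by simp
qed

section \<open>Mean durations and closed forms of the two probabilities\<close>

definition mean_off :: real where "mean_off = (\<Sum>\<mu>\<in>S. q \<mu> / \<mu>)"

lemma mean_off: "mean_duration (exponential_mixture S q) = mean_off"
  by (simp add: mean_off_def mean_exponential_mixture[OF finite_S S_pos q_nonneg])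

lemma mean_off_pos: "0 < mean_off"
  unfolding mean_off_def using S_ne by (intro sum_pos divide_pos_pos q_pos S_pos) auto

lemma mean_on: "mean_duration (exponential_density l) = 1 / l"
  using mean_exponential_mixture[of "{l}" "\<lambda>_. 1"] l_pos by (simp add: exponential_density_eq_mixture)

lemma same_state_prob_eq_parity_prob:
  "same_state_prob f g t = parity_prob (\<lambda>k. duration_law (period_density f g k)) True t"
  by (simp add: same_state_prob_def parity_prob_def channel_measure_def parity_event_def)

lemma P_ON_ON_eq:
  assumes "0 \<le> t"
  shows "of_real (P_ON_ON (exponential_density l) (exponential_mixture S q) t) = 1 - of_real l * residue_sum Q num t"
proof -
  have "residual_density (exponential_density l) = exponential_mixture {l} (\<lambda>\<mu>. 1 / (\<mu> * (1 / l)))"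
    using residual_exponential_mixture[of "{l}" "\<lambda>_. 1"] l_pos
    unfolding exponential_density_eq_mixture[symmetric] mean_on by simp
  also have "\<dots> = exponential_density l"
    using l_pos by (simp add: exponential_mixture_def fun_eq_iff)
  finally have "residual_density (exponential_density l) = exponential_density l" .
  then have "(\<lambda>k. duration_law (period_density (exponential_density l) (exponential_mixture S q) k)) = alternating X Y"
    by (intro ext) (simp add: period_density_def alternating_def)
  then show ?thesis
    using parity_prob_on[OF assms] by (simp add: P_ON_ON_def same_state_prob_eq_parity_prob)
qed

lemma P_OFF_OFF_eq:
  assumes t: "0 \<le> t"
  shows "of_real (P_OFF_OFF (exponential_density l) (exponential_mixture S q) t) = 1 - residue_sum Q num t / of_real mean_off"
proof -
  let ?w = "\<lambda>\<mu>. q \<mu> / (\<mu> * mean_off)"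
  let ?M = "\<lambda>k. duration_law (period_density (exponential_mixture S q) (exponential_density l) k)"
  have res: "residual_density (exponential_mixture S q) = exponential_mixture S ?w"
    using residual_exponential_mixture[OF finite_S S_pos q_nonneg] by (simp add: mean_off)
  have w: "0 \<le> ?w \<mu>" if "\<mu> \<in> S" for \<mu>
    using mean_off_pos S_pos[OF that] q_nonneg[OF that] by simp
  have w1: "sum ?w S = 1"
    using mean_off_pos by (simp add: mean_off_def sum_divide_distrib[symmetric] flip: divide_divide_eq_left)
  have M0: "?M 0 = duration_law (exponential_mixture S ?w)" by (simp add: period_density_def res)
  \<comment> \<open>After the residual OFF period the channel restarts at the beginning of an ON
    period.\<close>
  have MSuc: "(\<lambda>i. ?M (Suc i)) = alternating X Y"
    by (auto simp: period_density_def alternating_def fun_eq_iff)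
  interpret XY: renewal_sequence "alternating X Y" by (rule renewal_sequence_alternating[OF X Y])
  interpret R: renewal_sequence ?M
  proof (rule renewal_sequence.intro)
    fix i
    have "prob_space (?M i) \<and> (AE x in ?M i. 0 \<le> x)"
    proof (cases i)
      case 0
      then show ?thesis
        using prob_space_exponential_mixture[OF finite_S S_pos w w1] AE_exponential_mixture_nonneg
        unfolding 0 M0 by blast
    next
      case (Suc j)
      have "?M i = alternating X Y j" using fun_cong[OF MSuc, of j] Suc by simp
      then show ?thesis using XY.prob[of j] XY.nonneg[of j] by metis
    qed
    then show "prob_space (?M i)" "AE x in ?M i. 0 \<le> x" by blast+
    show "sets (?M i) = sets borel" by simp
  qed
  have V: "(\<lambda>x. if x \<le> t then of_real (parity_prob (alternating X Y) False (t - x)) else (1::complex)) =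
     (\<lambda>x. if x \<le> t then of_real l * residue_sum Q num (t - x) else 1)"
    using parity_prob_off by auto
  have "of_real (P_OFF_OFF (exponential_density l) (exponential_mixture S q) t) =
      (\<integral>x. (if x \<le> t then of_real (parity_prob (alternating X Y) False (t - x)) else (1::complex)) \<partial>?M 0)"
    using R.parity_prob_renewal_complex[OF t, of True]
    unfolding P_OFF_OFF_def same_state_prob_eq_parity_prob MSuc not_True_eq_False by simp
  also have "\<dots> = (\<integral>x. (if x \<le> t then of_real l * residue_sum Q num (t - x) else 1) \<partial>duration_law (exponential_mixture S ?w))"
    unfolding V M0 ..
  \<comment> \<open>The ODE concerns each rate separately, so the a_mu may be averaged with the
    residual weights.\<close>
  also have "\<dots> = (\<Sum>\<mu>\<in>S. ?w \<mu> *\<^sub>R residue_sum Q (state_num \<mu>) t)"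
    using exponential_mixture_renewal_integral[OF finite_S S_pos w t state_num_ode residue_state_num_0]
    by (simp add: has_bochner_integral_iff continuous_intros continuous_on_residue_sum)
  also have "\<dots> = (\<Sum>\<mu>\<in>S. (q \<mu> / \<mu>) *\<^sub>R residue_sum Q (state_num \<mu>) t) / of_real mean_off"
    by (simp add: sum_divide_distrib scaleR_conv_of_real mult_ac)
  also have "\<dots> = 1 - residue_sum Q num t / of_real mean_off"
    using mean_off_pos by (simp only: sum_state_num mean_off_def[symmetric]) (simp add: diff_divide_distrib)
  finally show ?thesis .
qed

end

section \<open>Laplace transform and limits\<close>

lemma has_bochner_integral_exp_Ici:
  fixes w :: complex
  assumes w: "0 < Re w"
  shows "has_bochner_integral lborel (\<lambda>t. indicator {0..} t *\<^sub>R exp (- (w * of_real t))) (1 / w)"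
proof -
  let ?f = "\<lambda>t. indicator {0..} t *\<^sub>R exp (- (w * of_real t))"
  \<comment> \<open>The exponential law of rate Re w serves only to dominate the integrand, whose
    norm is exp(-Re w t).\<close>
  interpret E: prob_space "density lborel (exponential_density (Re w))"
    using w by (rule prob_space_exponential_density)
  have "integrable (density lborel (exponential_density (Re w))) (\<lambda>_. 1::real)" by simp
  then have "integrable lborel (\<lambda>t. exponential_density (Re w) t *\<^sub>R (1::real))"
    by (subst (asm) integrable_density) (use w in auto)
  then have "integrable lborel (\<lambda>t. 1 / Re w * exponential_density (Re w) t)" by simp
  then have int: "integrable lborel ?f"
    by (rule Bochner_Integration.integrable_bound)
      (use w in \<open>auto intro!: AE_I2 simp: exponential_density_def indicator_def mult.commute\<close>)
  \<comment> \<open>Given integrability, the value is the limit of the truncated integrals.\<close>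
  have partial: "(\<integral>t. indicator {..T} t *\<^sub>R ?f t \<partial>lborel) = 1 / w - exp (- (w * of_real T)) / w" if "0 \<le> T" for T
  proof -
    have "(\<integral>t. indicator {0..T} t *\<^sub>R exp (- (w * of_real t)) \<partial>lborel) =
        - exp (- (w * of_real T)) / w - (- exp (- (w * of_real 0)) / w)"
    proof (rule integral_FTC_atLeastAtMost[OF that])
      fix t
      have "((\<lambda>s. - exp (- (w * s)) / w) has_field_derivative exp (- (w * of_real t))) (at (of_real t))"
        using w by (auto intro!: derivative_eq_intros)
      from has_vector_derivative_real_field[OF this]
      show "((\<lambda>t. - exp (- (w * of_real t)) / w) has_vector_derivative exp (- (w * of_real t))) (at t within {0..T})"
        by (rule has_vector_derivative_at_within)
    qed (auto intro!: continuous_intros)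
    moreover have "(\<lambda>t. indicator {..T} t *\<^sub>R ?f t) = (\<lambda>t. indicator {0..T} t *\<^sub>R exp (- (w * of_real t)))"
      by (auto simp: indicator_def)
    ultimately show ?thesis by simp
  qed
  have "((\<lambda>T. exp (- (w * of_real T))) \<longlongrightarrow> 0) at_top"
  proof (rule tendsto_norm_zero_cancel)
    have "((\<lambda>T. exp (- (Re w * T))) \<longlongrightarrow> 0) at_top"
      using w by real_asymp
    then show "((\<lambda>T. norm (exp (- (w * of_real T)))) \<longlongrightarrow> 0) at_top" by simp
  qed
  then have "((\<lambda>T. 1 / w - exp (- (w * of_real T)) / w) \<longlongrightarrow> 1 / w - 0 / w) at_top"
    using w by (intro tendsto_intros) auto
  then have "((\<lambda>T. \<integral>t. indicator {..T} t *\<^sub>R ?f t \<partial>lborel) \<longlongrightarrow> 1 / w) at_top"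
    by (rule Lim_transform_eventually[THEN tendsto_eq_rhs])
      (auto intro!: eventually_mono[OF eventually_ge_at_top[of 0]] partial[symmetric] simp del: scaleR_scaleR)
  from tendsto_unique[OF _ this tendsto_integral_at_top[OF _ int]]
  show ?thesis using int by (simp add: has_bochner_integral_iff)
qed

lemma eventually_poly_nz:
  fixes p :: "complex poly"
  assumes "p \<noteq> 0"
  shows "\<forall>\<^sub>F s in at a. poly p s \<noteq> 0"
proof -
  have "finite ({s. poly p s = 0} - {a})" using poly_roots_finite[OF assms] by simp
  then have "\<forall>\<^sub>F s in nhds a. s \<in> - ({s. poly p s = 0} - {a})"
    by (intro eventually_nhds_in_open open_Compl finite_imp_closed) auto
  then show ?thesis by (auto simp: eventually_at_filter elim!: eventually_mono)
qed

text \<open>Repeated rates contribute a common factor \<open>C\<close> of the paper's numerator and denominator.\<close>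

lemma prod_linear_factors_group:
  fixes a :: "'i \<Rightarrow> 'a :: idom"
  assumes I: "finite I"
  obtains C where
    "(\<Prod>i\<in>I. [:a i, 1:]) = C * (\<Prod>\<mu>\<in>a ` I. [:\<mu>, 1:])"
    "\<And>i. i \<in> I \<Longrightarrow> (\<Prod>j\<in>I - {i}. [:a j, 1:]) = C * (\<Prod>\<mu>\<in>a ` I - {a i}. [:\<mu>, 1:])"
    "\<And>z. poly C z = 0 \<Longrightarrow> \<exists>i\<in>I. z = - a i"
proof -
  \<comment> \<open>R picks one index per value; C collects the factors of the other
    indices.\<close>
  define R where "R = inv_into I a ` (a ` I)"
  have R: "R \<subseteq> I" by (auto simp: R_def inv_into_into)
  have bij: "bij_betw a R (a ` I)"
    by (rule bij_betwI[where g = "inv_into I a"]) (auto simp: R_def f_inv_into_f inv_into_into)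
  define C where "C = (\<Prod>i\<in>I - R. [:a i, 1:])"
  have full: "(\<Prod>i\<in>I. [:a i, 1:]) = C * (\<Prod>\<mu>\<in>a ` I. [:\<mu>, 1:])"
    using prod.subset_diff[OF R I, of "\<lambda>i. [:a i, 1:]"] prod.reindex_bij_betw[OF bij, of "\<lambda>\<mu>. [:\<mu>, 1:]"]
    by (simp add: C_def)
  moreover have "(\<Prod>j\<in>I - {i}. [:a j, 1:]) = C * (\<Prod>\<mu>\<in>a ` I - {a i}. [:\<mu>, 1:])" if i: "i \<in> I" for i
  proof -
    \<comment> \<open>The index i need not be in R, so the claim is multiplied by its linear factor,
      compared with the full product, and cancelled.\<close>
    have "[:a i, 1:] * (\<Prod>j\<in>I - {i}. [:a j, 1:]) = (\<Prod>j\<in>I. [:a j, 1:])"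
      using I i by (rule prod.remove[symmetric])
    also have "\<dots> = [:a i, 1:] * (C * (\<Prod>\<mu>\<in>a ` I - {a i}. [:\<mu>, 1:]))"
      unfolding full using I i by (subst prod.remove[of "a ` I" "a i"]) (auto simp only: finite_imageI imageI mult_ac)
    finally show ?thesis by (simp only: mult_cancel_left) auto
  qed
  moreover have "\<exists>i\<in>I. z = - a i" if "poly C z = 0" for z
    using that I by (auto simp: C_def poly_prod add_eq_0_iff2) (metis minus_minus)
  ultimately show thesis by (rule that)
qed

lemma hyperexponential_eq_mixture:
  "hyperexponential_density n p lam =
    exponential_mixture (lam ` {1..n}) (\<lambda>\<mu>. \<Sum>i | i \<in> {1..n} \<and> lam i = \<mu>. p i)"
proof
  fix t
  have "hyperexponential_density n p lam t =
      (\<Sum>\<mu>\<in>lam ` {1..n}. \<Sum>i | i \<in> {1..n} \<and> lam i = \<mu>. p i * exponential_density (lam i) t)"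
    unfolding hyperexponential_density_def by (rule sum.group[symmetric]) auto
  also have "\<dots> = exponential_mixture (lam ` {1..n}) (\<lambda>\<mu>. \<Sum>i | i \<in> {1..n} \<and> lam i = \<mu>. p i) t"
    unfolding exponential_mixture_def by (intro sum.cong) (auto simp: sum_distrib_right)
  finally show "hyperexponential_density n p lam t =
    exponential_mixture (lam ` {1..n}) (\<lambda>\<mu>. \<Sum>i | i \<in> {1..n} \<and> lam i = \<mu>. p i) t" .
qed

section \<open>Transform of the closed form and limits at the roots\<close>

context hyperexponential_channel
begin

lemma residue_sum_num_eq:
  "residue_sum Q num t = poly num 0 / poly den 0 +
    (\<Sum>z | poly den z = 0. poly num z * exp (z * of_real t) / poly (pderiv Q) z)"
  using den_0_nz poly_roots_finite[OF den_nz]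
  by (simp add: residue_sum_def Z_eq) (simp add: poly_pderiv_Q)

text \<open>Termwise integration of the closed form: exp(z t) transforms into 1 / (s - z), because
  every root has nonpositive real part, and partial fractions resum the terms.\<close>

lemma laplace_P_OFF_OFF:
  fixes s :: complex
  assumes s: "0 < Re s"
  defines "P \<equiv> P_OFF_OFF (exponential_density l) (exponential_mixture S q)"
  shows "set_integrable lborel {0..} (laplace_integrand P s)"
    and "laplace_transform P s = 1 / s - 1 / of_real mean_off * (poly num s / poly Q s)"
proof -
  let ?c = "\<lambda>z. poly num z / poly (pderiv Q) z / of_real mean_off"
  have "0 < Re (s - z)" if "z \<in> Z" for z using that s den_root(3)[of z] by (auto simp: poly_Q)
  then have "has_bochner_integral lborel (\<lambda>t. indicator {0..} t *\<^sub>R exp (- (s * of_real t)) -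
      (\<Sum>z\<in>Z. ?c z * (indicator {0..} t *\<^sub>R exp (- ((s - z) * of_real t)))))
      (1 / s - (\<Sum>z\<in>Z. ?c z * (1 / (s - z))))"
    using s by (intro has_bochner_integral_diff has_bochner_integral_sum has_bochner_integral_mult_right
        has_bochner_integral_exp_Ici) auto
  also have "(\<lambda>t. indicator {0..} t *\<^sub>R exp (- (s * of_real t)) -
      (\<Sum>z\<in>Z. ?c z * (indicator {0..} t *\<^sub>R exp (- ((s - z) * of_real t))))) =
      (\<lambda>t. indicator {0..} t *\<^sub>R laplace_integrand P s t)"
  proof
    fix t
    have "exp (- (s * of_real t)) * of_real (P t) = exp (- (s * of_real t)) - (\<Sum>z\<in>Z. ?c z * exp (- ((s - z) * of_real t)))"
      if "0 \<le> t"
      unfolding P_def P_OFF_OFF_eq[OF that] residue_sum_def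
      by (simp add: algebra_simps sum_divide_distrib sum_distrib_left exp_diff exp_minus divide_simps)
    then show "indicator {0..} t *\<^sub>R exp (- (s * of_real t)) -
      (\<Sum>z\<in>Z. ?c z * (indicator {0..} t *\<^sub>R exp (- ((s - z) * of_real t)))) =
      indicator {0..} t *\<^sub>R laplace_integrand P s t"
      by (cases "0 \<le> t") (auto simp: laplace_integrand_def)
  qed
  also have "(\<Sum>z\<in>Z. ?c z * (1 / (s - z))) = (\<Sum>z\<in>Z. poly num z / poly (pderiv Q) z / (s - z)) / of_real mean_off"
    by (simp add: sum_divide_distrib mult_ac)
  also have "(\<Sum>z\<in>Z. poly num z / poly (pderiv Q) z / (s - z)) = poly num s / poly Q s"
    using s den_root(3)[of s] degree_num by (intro partial_fractions[symmetric]) (auto simp: poly_Q degree_Q)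
  finally have "has_bochner_integral lborel (\<lambda>t. indicator {0..} t *\<^sub>R laplace_integrand P s t)
      (1 / s - poly num s / poly Q s / of_real mean_off)" .
  then show "set_integrable lborel {0..} (laplace_integrand P s)"
    and "laplace_transform P s = 1 / s - 1 / of_real mean_off * (poly num s / poly Q s)"
    by (auto simp: has_bochner_integral_iff set_integrable_def laplace_transform_def set_lebesgue_integral_def)
qed

text \<open>A multiple root of \<open>D\<close> is a root of \<open>C\<close> and not of \<open>den\<close>; its limit is \<open>0\<close>, so every
  residue is counted once.\<close>

context
  fixes C N D :: "complex poly"
  assumes C: "\<And>z. poly C z = 0 \<Longrightarrow> z \<in> (\<lambda>\<mu>. - of_real \<mu>) ` S" and C_nz: "C \<noteq> 0"
    and N: "N = C * num" and D: "D = C * den"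
begin

lemma residue_at_0:
  "((\<lambda>s. s * poly N s * exp (s * of_real t) / (s * poly D s)) \<longlongrightarrow> poly num 0 / poly den 0) (at 0)"
proof -
  have "((\<lambda>s. poly num s * exp (s * of_real t) / poly den s) \<longlongrightarrow> poly num 0 * exp (0 * of_real t) / poly den 0) (at 0)"
    using den_0_nz by (intro tendsto_intros)
  moreover have "\<forall>\<^sub>F s in at 0. poly num s * exp (s * of_real t) / poly den s =
      s * poly N s * exp (s * of_real t) / (s * poly D s)"
    using eventually_poly_nz[OF C_nz] eventually_neq_at_within[of 0]
    by eventually_elim (simp add: N D)
  ultimately show ?thesis by (simp add: tendsto_cong)
qed

lemma residue_at_root:
  assumes a: "poly D a = 0"
  shows "((\<lambda>s. (s - a) * poly N s * exp (s * of_real t) / (s * poly D s)) \<longlongrightarrow>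
    (if poly den a = 0 then poly num a * exp (a * of_real t) / poly (pderiv Q) a else 0)) (at a)"
proof (cases "poly den a = 0")
  case True
  have "(poly Q has_field_derivative poly (pderiv Q) a) (at a)" by (rule poly_DERIV)
  \<comment> \<open>As Q(a) = 0, the quotient Q(s) / (s - a) is a difference quotient and tends to
    Q'(a).\<close>
  then have "((\<lambda>s. (poly Q s - poly Q a) / (s - a)) \<longlongrightarrow> poly (pderiv Q) a) (at a)"
    by (simp add: has_field_derivative_iff)
  moreover have "poly Q a = 0" using True by (simp add: poly_Q)
  moreover have "poly (pderiv Q) a \<noteq> 0" using \<open>poly Q a = 0\<close> by (rule pderiv_Q_nz)
  ultimately have "((\<lambda>s. poly num s * exp (s * of_real t) / (poly Q s / (s - a))) \<longlongrightarrow>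
      poly num a * exp (a * of_real t) / poly (pderiv Q) a) (at a)"
    by (intro tendsto_intros) auto
  moreover have "\<forall>\<^sub>F s in at a. poly num s * exp (s * of_real t) / (poly Q s / (s - a)) =
      (s - a) * poly N s * exp (s * of_real t) / (s * poly D s)"
    using eventually_poly_nz[OF C_nz] by eventually_elim (simp add: N D poly_Q)
  ultimately show ?thesis using True by (simp add: tendsto_cong)
next
  case False
  then have "poly C a = 0" using a by (simp add: D)
  then obtain \<mu> where "\<mu> \<in> S" "a = - of_real \<mu>" using C by blast
  then have a0: "a \<noteq> 0" using S_pos by force
  \<comment> \<open>After cancelling C the denominator is nonzero at a, so the factor s - a forces
    the limit 0.\<close>
  have "((\<lambda>s. (s - a) * poly num s * exp (s * of_real t) / (s * poly den s)) \<longlongrightarrow>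
      (a - a) * poly num a * exp (a * of_real t) / (a * poly den a)) (at a)"
    using a0 False by (intro tendsto_intros) auto
  moreover have "\<forall>\<^sub>F s in at a. (s - a) * poly num s * exp (s * of_real t) / (s * poly den s) =
      (s - a) * poly N s * exp (s * of_real t) / (s * poly D s)"
    using eventually_poly_nz[OF C_nz] by eventually_elim (simp add: N D)
  ultimately show ?thesis using False by (simp add: tendsto_cong)
qed

lemma sum_residues:
  assumes roots: "proots D = image_mset r (mset_set {1..n})"
  shows "residue_sum Q num t = poly num 0 / poly den 0 +
    (\<Sum>i=1..n::nat. if poly den (r i) = 0 then poly num (r i) * exp (r i * of_real t) / poly (pderiv Q) (r i) else 0)"
proof -
  let ?f = "\<lambda>z. if poly den z = 0 then poly num z * exp (z * of_real t) / poly (pderiv Q) z else 0"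
  have fin: "finite {z. poly den z = 0}" by (simp add: poly_roots_finite)
  have "rsquarefree den" using den_root(4) by (auto simp: rsquarefree_roots)
  \<comment> \<open>Simplicity makes this multiset a set, so each root of \<open>den\<close> is
    listed exactly once among the roots of \<open>den\<close>.\<close>
  then have den_roots: "proots den = mset_set {z. poly den z = 0}"
    using fin by (intro multiset_eqI) (auto simp: count_mset_set' rsquarefree_root_order order_0I)
  have "(\<Sum>i=1..n. ?f (r i)) = sum_mset (image_mset ?f (proots D))"
    by (simp add: roots sum_unfold_sum_mset image_mset.compositionality o_def)
  also have "\<dots> = sum_mset (image_mset ?f (proots C)) + sum_mset (image_mset ?f (proots den))"
    using C_nz by (simp add: D proots_mult)
  \<comment> \<open>Roots of C are negated rates, where \<open>den\<close> does not vanish, so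
    \<open>?f\<close> is 0 there.\<close>
  also have "sum_mset (image_mset ?f (proots C)) = 0"
    using C C_nz poly_den_at_rate by (intro sum_mset.neutral) auto
  also have "sum_mset (image_mset ?f (proots den)) = (\<Sum>z | poly den z = 0. ?f z)"
    by (simp only: den_roots sum_unfold_sum_mset)
  also have "\<dots> = (\<Sum>z | poly den z = 0. poly num z * exp (z * of_real t) / poly (pderiv Q) z)"
    by (intro sum.cong) auto
  finally show ?thesis by (simp add: residue_sum_num_eq)
qed

end

end

theorem mainTheorem3:
  fixes n :: nat and p lam :: "nat \<Rightarrow> real" and lam_on :: real
    and f_X f_Y :: "real \<Rightarrow> real" and N D :: "complex poly" and r :: "nat \<Rightarrow> complex"
  assumes p_pos: "\<And>i. i \<in> {1..n} \<Longrightarrow> p i > 0"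
    and p_sum: "(\<Sum>i=1..n. p i) = 1"
    and lam_pos: "\<And>i. i \<in> {1..n} \<Longrightarrow> lam i > 0"
    and lam_on_pos: "lam_on > 0"
    and f_Y: "f_Y = hyperexponential_density n p lam"
    and f_X: "f_X = exponential_density lam_on"
    and N: "N = N_poly n p lam"
    and D: "D = D_poly n p lam lam_on"
    and roots: "proots D = image_mset r (mset_set {1..n})"
  shows "(\<forall>s::complex. Re s > 0 \<longrightarrow>
            set_integrable lborel {0..} (laplace_integrand (P_OFF_OFF f_X f_Y) s) \<and>
            laplace_transform (P_OFF_OFF f_X f_Y) s =
              1 / s - 1 / complex_of_real (mean_duration f_Y) * (poly N s / (s * poly D s))) \<and>
         (\<forall>t::real. t \<ge> 0 \<longrightarrow>
            (\<exists>L\<^sub>0 L.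
               ((\<lambda>s. s * poly N s * exp (s * complex_of_real t) / (s * (\<Prod>k=1..n. s - r k)))
                  \<longlongrightarrow> L\<^sub>0) (at 0) \<and>
               (\<forall>i\<in>{1..n}.
                  ((\<lambda>s. (s - r i) * poly N s * exp (s * complex_of_real t) / (s * (\<Prod>k=1..n. s - r k)))
                     \<longlongrightarrow> L i) (at (r i))) \<and>
               complex_of_real (P_OFF_OFF f_X f_Y t) =
                 1 - 1 / complex_of_real (mean_duration f_Y) * (L\<^sub>0 + (\<Sum>i=1..n. L i)) \<and>
               complex_of_real (P_ON_ON f_X f_Y t) =
                 1 - 1 / complex_of_real (mean_duration f_X) * (L\<^sub>0 + (\<Sum>i=1..n. L i))))"
proof -
  define S where "S = lam ` {1..n}"
  define q where "q \<mu> = (\<Sum>i | i \<in> {1..n} \<and> lam i = \<mu>. p i)" for \<mu>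
  interpret hyperexponential_channel S q lam_on
  proof
    show "0 < q \<mu>" if "\<mu> \<in> S" for \<mu>
      using that unfolding q_def S_def by (intro sum_pos p_pos) auto
    show "sum q S = 1"
      unfolding q_def S_def p_sum[symmetric] by (rule sum.group) auto
  qed (auto simp: S_def lam_pos lam_on_pos)
  have f_Y': "f_Y = exponential_mixture S q"
    unfolding f_Y hyperexponential_eq_mixture S_def q_def[abs_def] ..
  obtain C :: "complex poly" where
    C1: "(\<Prod>i\<in>{1..n}. [:complex_of_real (lam i), 1:]) = C * (\<Prod>\<mu>\<in>(\<lambda>i. complex_of_real (lam i)) ` {1..n}. [:\<mu>, 1:])"
    and C2: "\<And>i. i \<in> {1..n} \<Longrightarrow> (\<Prod>j\<in>{1..n} - {i}. [:complex_of_real (lam j), 1:]) =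
      C * (\<Prod>\<mu>\<in>(\<lambda>i. complex_of_real (lam i)) ` {1..n} - {complex_of_real (lam i)}. [:\<mu>, 1:])"
    and C3: "\<And>z. poly C z = 0 \<Longrightarrow> \<exists>i\<in>{1..n}. z = - complex_of_real (lam i)"
    by (rule prod_linear_factors_group[of "{1..n}" "\<lambda>i. complex_of_real (lam i)"]) auto
  have im: "(\<lambda>i. complex_of_real (lam i)) ` {1..n} = of_real ` S" by (auto simp: S_def)
  have C_full: "(\<Prod>i=1..n. [:complex_of_real (lam i), 1:]) = C * full"
    unfolding C1 im full_def by (simp add: prod.reindex inj_on_def)
  have C_cofactor: "(\<Prod>j\<in>{1..n} - {i}. [:complex_of_real (lam j), 1:]) = C * cofactor (lam i)" if "i \<in> {1..n}" for i
  proof -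
    have "complex_of_real ` S - {complex_of_real (lam i)} = of_real ` (S - {lam i})" by auto
    then show ?thesis unfolding C2[OF that] im cofactor_def by (simp add: prod.reindex inj_on_def)
  qed
  have "N = (\<Sum>i=1..n. C * smult (of_real (p i)) (cofactor (lam i)))"
    unfolding N N_poly_def using C_cofactor by (intro sum.cong) auto
  also have "\<dots> = C * (\<Sum>i=1..n. smult (of_real (p i)) (cofactor (lam i)))"
    by (simp add: sum_distrib_left)
  also have "(\<Sum>i=1..n. smult (of_real (p i)) (cofactor (lam i))) =
      (\<Sum>\<mu>\<in>S. \<Sum>i | i \<in> {1..n} \<and> lam i = \<mu>. smult (of_real (p i)) (cofactor (lam i)))"
    unfolding S_def by (rule sum.group[symmetric]) auto
  also have "\<dots> = num"
    unfolding num_def q_def by (intro sum.cong) (auto simp: smult_sum)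
  finally have N': "N = C * num" .
  have D': "D = C * den"
    unfolding D D_poly_def C_full N[symmetric] N' den_def by (simp add: algebra_simps)
  have C_nz: "C \<noteq> 0"
  proof
    assume "C = 0"
    then have "(\<Prod>i=1..n. [:complex_of_real (lam i), 1:]) = 0" using C_full by simp
    then show False by simp
  qed
  have C_roots: "z \<in> (\<lambda>\<mu>. - of_real \<mu>) ` S" if "poly C z = 0" for z
    using C3[OF that] by (auto simp: S_def)
  \<comment> \<open>Only a monic D equals the product of the s - r k that occurs in the
    limits.\<close>
  have "lead_coeff (\<Prod>i=1..n. [:complex_of_real (lam i), 1:]) = 1"
    by (simp add: lead_coeff_prod)
  moreover have "lead_coeff full = 1" by (simp add: full_def lead_coeff_prod)
  ultimately have "lead_coeff C = 1" unfolding C_full lead_coeff_mult by simp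
  then have "lead_coeff D = 1" by (simp add: D' lead_coeff_mult lead_coeff_den)
  then have "D = (\<Prod>k=1..n. [:- r k, 1:])"
    using complex_poly_decompose_multiset[of D]
    by (simp add: roots prod_unfold_prod_mset image_mset.compositionality o_def)
  then have poly_D: "(\<Prod>k=1..n. s - r k) = poly D s" for s
    by (simp add: poly_prod)
  have root: "poly D (r i) = 0" if "i \<in> {1..n}" for i
    using that by (auto simp flip: poly_D)
  show ?thesis
  proof (intro conjI allI impI)
    fix s :: complex assume s: "Re s > 0"
    \<comment> \<open>In the right half-plane C has no root, so it cancels from N / D.\<close>
    have "s \<notin> (\<lambda>\<mu>. - of_real \<mu>) ` S" using s by (auto dest: S_pos)
    then have "poly C s \<noteq> 0" using C_roots by blast
    then have "poly N s / (s * poly D s) = poly num s / poly Q s" by (simp add: N' D' poly_Q)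
    then show "set_integrable lborel {0..} (laplace_integrand (P_OFF_OFF f_X f_Y) s)"
      "laplace_transform (P_OFF_OFF f_X f_Y) s =
        1 / s - 1 / complex_of_real (mean_duration f_Y) * (poly N s / (s * poly D s))"
      using laplace_P_OFF_OFF[OF s] by (simp_all add: f_X f_Y' mean_off)
  next
    fix t :: real assume t: "0 \<le> t"
    let ?L = "\<lambda>i. if poly den (r i) = 0 then poly num (r i) * exp (r i * of_real t) / poly (pderiv Q) (r i) else 0"
    have sum: "residue_sum Q num t = poly num 0 / poly den 0 + (\<Sum>i=1..n. ?L i)"
      by (rule sum_residues[OF C_roots C_nz N' D' roots])
    show "\<exists>L\<^sub>0 L.
       ((\<lambda>s. s * poly N s * exp (s * complex_of_real t) / (s * (\<Prod>k=1..n. s - r k))) \<longlongrightarrow> L\<^sub>0) (at 0) \<and>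
       (\<forall>i\<in>{1..n}.
          ((\<lambda>s. (s - r i) * poly N s * exp (s * complex_of_real t) / (s * (\<Prod>k=1..n. s - r k)))
             \<longlongrightarrow> L i) (at (r i))) \<and>
       complex_of_real (P_OFF_OFF f_X f_Y t) =
         1 - 1 / complex_of_real (mean_duration f_Y) * (L\<^sub>0 + (\<Sum>i=1..n. L i)) \<and>
       complex_of_real (P_ON_ON f_X f_Y t) =
         1 - 1 / complex_of_real (mean_duration f_X) * (L\<^sub>0 + (\<Sum>i=1..n. L i))"
    proof (intro exI[of _ "poly num 0 / poly den 0"] exI[of _ ?L] conjI ballI)
      show "complex_of_real (P_OFF_OFF f_X f_Y t) =
         1 - 1 / complex_of_real (mean_duration f_Y) * (poly num 0 / poly den 0 + (\<Sum>i=1..n. ?L i))"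
        unfolding f_X f_Y' mean_off P_OFF_OFF_eq[OF t] sum by simp
      show "complex_of_real (P_ON_ON f_X f_Y t) =
         1 - 1 / complex_of_real (mean_duration f_X) * (poly num 0 / poly den 0 + (\<Sum>i=1..n. ?L i))"
        unfolding f_X f_Y' mean_on P_ON_ON_eq[OF t] sum by simp
      show "((\<lambda>s. s * poly N s * exp (s * complex_of_real t) / (s * (\<Prod>k=1..n. s - r k)))
          \<longlongrightarrow> poly num 0 / poly den 0) (at 0)"
        unfolding poly_D by (rule residue_at_0[OF C_roots C_nz N' D'])
      show "((\<lambda>s. (s - r i) * poly N s * exp (s * complex_of_real t) / (s * (\<Prod>k=1..n. s - r k)))
          \<longlongrightarrow> ?L i) (at (r i))" if "i \<in> {1..n}" for i
        unfolding poly_D by (rule residue_at_root[OF C_roots C_nz N' D' root[OF that]])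
    qed
  qed
qed

end
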